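(* Let $\Omega$ be a smooth bounded domain in $\mathbb{R}^N$, $N\ge 2$, let $p>1$ and let $f(u)=(u+1)^p$. Suppose \[ \frac{N}{4} < \frac{p}{p-1} + \frac{p+1}{p-1}\left( \sqrt{\frac{2p}{p+1}} + \sqrt{\frac{2p}{p+1}-\sqrt{\frac{2p}{p+1}}} - \frac12 \right). \] Then the extremal solution $u^*$ associated with the problem $(N)_{\lambda^*}$: $\Delta^2 u=\lambda^* f(u)$ in $\Omega$, $u=\Delta u=0$ on $\partial\Omega$, is bounded (i.e. $u^*\in L^\infty(\Omega)$).
   Context: For $\lambda\ge 0$, $(N)_\lambda$ denotes the fourth order Navier problem \[ \Delta^2 u=\lambda f(u)\ \text{ in }\Omega,\qquad u=\Delta u=0\ \text{ on }\partial\Omega, \] here with $f(u)=(u+1)^p$ (solutions take values where $f$ is defined; they are nonnegative by the maximum principle). A smooth solution $u$ of $(N)_\lambda$ is called minimal if $u\le v$ a.e. in $\Omega$ for any solution $v$ of $(N)_\lambda$. The extremal parameter is $\lambda^*:=\sup\{\lambda>0:\ \text{there exists a smooth solution of }(N)_\lambda\}$. It is known that $0<\lambda^*<\infty$, that for each $0<\lambda<\lambda^*$ there exists a smooth minimal solution $u_\lambda$ of $(N)_\lambda$, and that for each $x\in\Omega$ the map $\lambda\mapsto u_\lambda(x)$ is strictly increasing on $(0,\lambda^* )$. The extremal solution is defined by $u^*(x):=\lim_{\lambda\nearrow\lambda^*}u_\lambda(x)$ for $x\in\Omega$. *)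

theory Defs
  imports "HOL-Analysis.Analysis" "HOL-Probability.Essential_Supremum"
begin

text \<open>Iterated directional derivatives; they are only meaningful at points of an open set on which
  the function is smooth.\<close>

primrec iterated_deriv :: "'a list \<Rightarrow> ('a::euclidean_space \<Rightarrow> real) \<Rightarrow> 'a \<Rightarrow> real" where
  "iterated_deriv [] u = u"
| "iterated_deriv (v # vs) u = (\<lambda>x. frechet_derivative (iterated_deriv vs u) (at x) v)"

definition smooth_on :: "'a::euclidean_space set \<Rightarrow> ('a \<Rightarrow> real) \<Rightarrow> bool" where
  "smooth_on S u \<longleftrightarrow> open S \<and> (\<forall>vs. \<forall>x\<in>S. iterated_deriv vs u differentiable (at x))"

text \<open>The class of functions in $C^\infty(\overline\Omega)$: all derivatives in \<open>\<Omega>\<close> have a continuous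
  extension to the closure. The values of \<open>u\<close> outside the closure are irrelevant.\<close>

definition smooth_on_closure :: "'a::euclidean_space set \<Rightarrow> ('a \<Rightarrow> real) \<Rightarrow> bool" where
  "smooth_on_closure \<Omega> u \<longleftrightarrow> smooth_on \<Omega> u \<and> continuous_on (closure \<Omega>) u \<and>
     (\<forall>vs. \<exists>g. continuous_on (closure \<Omega>) g \<and> (\<forall>x\<in>\<Omega>. g x = iterated_deriv vs u x))"

definition laplacian :: "('a::euclidean_space \<Rightarrow> real) \<Rightarrow> 'a \<Rightarrow> real" where
  "laplacian u x = (\<Sum>b\<in>Basis. iterated_deriv [b, b] u x)"

text \<open>Near each boundary point, the domain is, up to a rotation taking the last coordinate direction
  to \<open>b\<close>, the region strictly above the graph of a smooth function of the other coordinates. Here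
  \<open>x - (x \<bullet> b) *\<^sub>R b\<close> is the projection to the hyperplane orthogonal to \<open>b\<close>.\<close>

definition smooth_boundary :: "'a::euclidean_space set \<Rightarrow> bool" where
  "smooth_boundary \<Omega> \<longleftrightarrow> (\<forall>x0\<in>frontier \<Omega>. \<exists>r>0. \<exists>b \<gamma>. norm b = 1 \<and> smooth_on UNIV \<gamma> \<and>
     \<Omega> \<inter> ball x0 r = {x \<in> ball x0 r. \<gamma> (x - (x \<bullet> b) *\<^sub>R b) < x \<bullet> b})"

definition smooth_bounded_domain :: "'a::euclidean_space set \<Rightarrow> bool" where
  "smooth_bounded_domain \<Omega> \<longleftrightarrow>
     open \<Omega> \<and> connected \<Omega> \<and> \<Omega> \<noteq> {} \<and> bounded \<Omega> \<and> smooth_boundary \<Omega>"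

text \<open>Smooth solutions of $\Delta^2 u = \lambda (u+1)^p$ in \<open>\<Omega>\<close>, $u = \Delta u = 0$ on the boundary. The
  condition \<open>- 1 \<le> u x\<close> says that \<open>u\<close> takes values in the domain of $t \mapsto (t+1)^p$. The
  boundary value of the Laplacian is that of its continuous extension from \<open>\<Omega>\<close>.\<close>

definition smooth_solution ::
    "'a::euclidean_space set \<Rightarrow> real \<Rightarrow> real \<Rightarrow> ('a \<Rightarrow> real) \<Rightarrow> bool" where
  "smooth_solution \<Omega> p l u \<longleftrightarrow> smooth_on_closure \<Omega> u \<and>
     (\<forall>x\<in>\<Omega>. - 1 \<le> u x) \<and>
     (\<forall>x\<in>\<Omega>. laplacian (laplacian u) x = l * (u x + 1) powr p) \<and>
     (\<forall>y\<in>frontier \<Omega>. u y = 0 \<and> (laplacian u \<longlongrightarrow> 0) (at y within \<Omega>))"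

definition minimal_solution ::
    "'a::euclidean_space set \<Rightarrow> real \<Rightarrow> real \<Rightarrow> ('a \<Rightarrow> real) \<Rightarrow> bool" where
  "minimal_solution \<Omega> p l u \<longleftrightarrow> smooth_solution \<Omega> p l u \<and>
     (\<forall>v. smooth_solution \<Omega> p l v \<longrightarrow> (AE x in lebesgue_on \<Omega>. u x \<le> v x))"

definition extremal_parameter :: "'a::euclidean_space set \<Rightarrow> real \<Rightarrow> ereal" where
  "extremal_parameter \<Omega> p = (SUP l \<in> {l. 0 < l \<and> (\<exists>u. smooth_solution \<Omega> p l u)}. ereal l)"

text \<open>The family of minimal solutions below the parameter \<open>L\<close>. Its members are unique
  on the closure of \<open>\<Omega>\<close>.\<close>

definition minimal_branch ::
    "'a::euclidean_space set \<Rightarrow> real \<Rightarrow> real \<Rightarrow> (real \<Rightarrow> 'a \<Rightarrow> real) \<Rightarrow> bool" where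
  "minimal_branch \<Omega> p L u \<longleftrightarrow>
     (\<forall>l\<in>{0<..<L}. minimal_solution \<Omega> p l (u l)) \<and>
     (\<forall>x\<in>\<Omega>. strict_mono_on {0<..<L} (\<lambda>l. u l x))"

text \<open>The extremal solution is the pointwise increasing limit of the minimal branch. It is a priori
  allowed to be infinite, so it takes extended real values. That the extremal
  parameter is positive and finite, and that a strictly increasing branch of minimal solutions
  exists, are classical facts about this problem, and are what makes the limit well defined.\<close>

definition extremal_solution ::
    "'a::euclidean_space set \<Rightarrow> real \<Rightarrow> ('a \<Rightarrow> ereal) \<Rightarrow> bool" where
  "extremal_solution \<Omega> p ustar \<longleftrightarrow>
     (\<exists>L u. extremal_parameter \<Omega> p = ereal L \<and> 0 < L \<and> minimal_branch \<Omega> p L u \<and>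
        (\<forall>x\<in>\<Omega>. ((\<lambda>l. ereal (u l x)) \<longlongrightarrow> ustar x) (at_left L)))"

end

theory Submission imports Defs
begin

text \<open>Write the problem as $-\Delta u = v$, $-\Delta v = \lambda (u+1)^p$. Two members
  $u_\lambda < u_\mu$ of the branch give a positive supersolution $u_\mu - u_\lambda$ of the linearised
  system; averaging the Picone inequalities of its two components gives
  $\sqrt{\lambda p} \int (u+1)^{(p-1)/2} \varphi^2 \le \int |\nabla\varphi|^2$. The maximum principle gives
  $(u+1)^{(p+1)/2} \le \sqrt{(p+1)/(2\lambda)}\, v + 1$. Testing with $\varphi = (v-1)_+^\alpha$ and using
  the equation for $v$ bounds $\int (u+1)^{(p-1)/2 + (p+1)\alpha}$ uniformly in $\lambda$ near $\lambda^*$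
  whenever $\alpha^2/(2\alpha-1) < \sqrt{2p/(p+1)}$. By the assumption on $N$ this exponent can be made larger
  than $(p-1)N/4$. Testing the equation for $v$ with the fundamental solution centred at a maximum
  point of $v$ then gives $\max v \le C (\max v + 1)^\theta$ with $\theta < 1$.\<close>

section \<open>Directional derivatives and integration by parts\<close>

text \<open>Both numerical thresholds come from balancing exponents. The comparison estimate spends
  one factor (u+1)^((p+1)/2) of (u+1)^p against v. In the energy inequality for w^\<alpha>, with w =
  (v-1)_+, the leading terms then carry sqrt p on the left and sqrt((p+1)/2)
  \<alpha>^2/(2\<alpha>-1) on the right, after division by sqrt \<lambda>; hence the condition on
  \<alpha>. For the sup bound let M = max v, so that u+1 is at most a constant times
  (M+1)^(2/(p+1)), and split (u+1)^p = (u+1)^(p-s) (u+1)^s. The second factor has to lie in L^q with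
  q > N/2 to be paired with the fundamental solution. The first is of order (M+1)^\<theta> with
  \<theta> < 1 when p - s < (p+1)/2, that is s > (p-1)/2. So an integrable power sq > (p-1)N/4 is
  what is needed. Truncation at level 1 makes every test function live on the compact set where v >=
  1; where v < 1 the comparison estimate already bounds u. All constants depend on \<lambda> only
  through bounds 0 < l0 <= \<lambda> <= l1.\<close>

definition has_dir_deriv :: "('a::euclidean_space \<Rightarrow> real) \<Rightarrow> real \<Rightarrow> 'a \<Rightarrow> 'a \<Rightarrow> bool" where
  "has_dir_deriv F D b x \<longleftrightarrow> ((\<lambda>t. F (x + t *\<^sub>R b)) has_real_derivative D) (at 0)"

lemma has_dir_deriv_line:
  assumes "has_dir_deriv F D b (x + s *\<^sub>R b)"
  shows "((\<lambda>t. F (x + t *\<^sub>R b)) has_real_derivative D) (at s)"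
proof -
  have "((\<lambda>t. F (x + s *\<^sub>R b + t *\<^sub>R b)) has_real_derivative D) (at 0)"
    using assms by (simp add: has_dir_deriv_def)
  then have "((\<lambda>t. F (x + (t + s) *\<^sub>R b)) has_real_derivative D) (at 0)"
    by (simp add: algebra_simps)
  then show ?thesis
    using DERIV_shift[of "\<lambda>t. F (x + t *\<^sub>R b)" D 0 s] by simp
qed

lemma has_dir_deriv_cong_open:
  assumes "has_dir_deriv F D b x" "open S" "x \<in> S" "\<And>y. y \<in> S \<Longrightarrow> F y = G y"
  shows "has_dir_deriv G D b x"
proof -
  have "isCont (\<lambda>t::real. x + t *\<^sub>R b) 0" by (intro continuous_intros)
  then have "((\<lambda>t::real. x + t *\<^sub>R b) \<longlongrightarrow> x) (nhds 0)"
    by (simp add: continuous_at_imp_continuous_at_within isCont_def tendsto_nhds_iff)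
  then have "eventually (\<lambda>t::real. x + t *\<^sub>R b \<in> S) (nhds 0)"
    using assms(2,3) by (simp add: topological_tendstoD)
  then have "eventually (\<lambda>t::real. F (x + t *\<^sub>R b) = G (x + t *\<^sub>R b)) (nhds 0)"
    by (rule eventually_mono) (use assms(4) in auto)
  then show ?thesis
    using assms(1) by (simp add: has_dir_deriv_def DERIV_cong_ev)
qed

lemma has_dir_deriv_const: "has_dir_deriv (\<lambda>x. c) 0 b x"
  by (simp add: has_dir_deriv_def)

lemma has_dir_deriv_mult:
  assumes "has_dir_deriv F D b x" "has_dir_deriv G E b x"
  shows "has_dir_deriv (\<lambda>x. F x * G x) (D * G x + F x * E) b x"
  using DERIV_mult[OF assms[unfolded has_dir_deriv_def]]
  by (simp add: has_dir_deriv_def mult.commute add.commute)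

lemma has_dir_deriv_diff:
  assumes "has_dir_deriv F D b x" "has_dir_deriv G E b x"
  shows "has_dir_deriv (\<lambda>x. F x - G x) (D - E) b x"
  using DERIV_diff[OF assms[unfolded has_dir_deriv_def]] by (simp add: has_dir_deriv_def)

lemma has_dir_deriv_add:
  assumes "has_dir_deriv F D b x" "has_dir_deriv G E b x"
  shows "has_dir_deriv (\<lambda>x. F x + G x) (D + E) b x"
  using DERIV_add[OF assms[unfolded has_dir_deriv_def]] by (simp add: has_dir_deriv_def)

lemma has_dir_deriv_compose:
  assumes "(\<psi> has_real_derivative d) (at (F x))" "has_dir_deriv F D b x"
  shows "has_dir_deriv (\<lambda>x. \<psi> (F x)) (d * D) b x"
proof -
  have "(\<psi> has_real_derivative d) (at (F (x + 0 *\<^sub>R b)))" using assms(1) by simp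
  from DERIV_chain2[OF this assms(2)[unfolded has_dir_deriv_def]]
  show ?thesis by (simp add: has_dir_deriv_def)
qed

lemma has_dir_deriv_frechet:
  assumes "F differentiable (at x)"
  shows "has_dir_deriv F (frechet_derivative F (at x) b) b x"
proof -
  have "(F has_derivative frechet_derivative F (at x)) (at (x + 0 *\<^sub>R b))"
    using assms by (simp add: frechet_derivative_works)
  moreover have "((\<lambda>t::real. x + t *\<^sub>R b) has_derivative (\<lambda>t. t *\<^sub>R b)) (at 0)"
    by (auto intro!: derivative_eq_intros)
  ultimately have "((\<lambda>t. F (x + t *\<^sub>R b)) has_derivative
      (\<lambda>t. frechet_derivative F (at x) (t *\<^sub>R b))) (at 0)"
    by (rule has_derivative_compose[rotated])
  moreover have "frechet_derivative F (at x) (t *\<^sub>R b) = t * frechet_derivative F (at x) b" for t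
    using linear_frechet_derivative[OF assms] by (simp add: linear_cmul)
  ultimately show ?thesis
    by (auto simp: has_dir_deriv_def has_field_derivative_def elim!: has_derivative_eq_rhs)
qed

lemma integrable_compact_support:
  fixes f :: "'a::euclidean_space \<Rightarrow> real"
  assumes "compact K" "continuous_on K f" "\<And>x. x \<notin> K \<Longrightarrow> f x = 0"
  shows "integrable lborel f"
proof -
  have "integrable lborel (\<lambda>x. indicator K x *\<^sub>R f x)"
    using assms(1,2) by (rule borel_integrable_compact)
  moreover have "(\<lambda>x. indicator K x *\<^sub>R f x) = f"
    using assms(3) by (auto simp: indicator_def fun_eq_iff)
  ultimately show ?thesis by simp
qed

text \<open>By translation invariance of Lebesgue measure all difference quotients have integral \<open>0\<close>.\<close>

lemma integral_dir_deriv_eq_0: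
  fixes F :: "'a::euclidean_space \<Rightarrow> real"
  assumes K: "compact K" and F0: "\<And>x. x \<notin> K \<Longrightarrow> F x = 0" and D0: "\<And>x. x \<notin> K \<Longrightarrow> D x = 0"
    and d: "\<And>x. x \<in> K \<Longrightarrow> has_dir_deriv F (D x) b x"
    and cF: "continuous_on K F" and cD: "continuous_on K D"
  shows "integral\<^sup>L lborel D = 0"
proof -
  \<comment> \<open>Off K the function vanishes on an open set, so the derivative exists everywhere.
    The mean value theorem below needs this on segments that may leave K.\<close>
  have d': "has_dir_deriv F (D x) b x" for x
  proof (cases "x \<in> K")
    case False
    have "has_dir_deriv F 0 b x"
      by (rule has_dir_deriv_cong_open[of "\<lambda>x. 0" _ _ _ "- K"])
         (use K F0 False in \<open>auto simp: has_dir_deriv_const compact_imp_closed open_Compl\<close>)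
    then show ?thesis using D0 False by simp
  qed (use d in auto)
  have iF: "integrable lborel F" using integrable_compact_support[OF K cF F0] .
  have iD: "integrable lborel D" using integrable_compact_support[OF K cD D0] .
  obtain C where C: "\<And>x. \<bar>D x\<bar> \<le> C" "C \<ge> 0"
  proof -
    have "bounded (D ` K)" using K cD by (simp add: compact_continuous_image compact_imp_bounded)
    then obtain B where "\<And>x. x \<in> K \<Longrightarrow> \<bar>D x\<bar> \<le> B" "B > 0"
      by (auto simp: bounded_pos)
    then have "\<bar>D x\<bar> \<le> B" for x using D0 by (cases "x \<in> K") auto
    then show ?thesis using that[of B] \<open>B > 0\<close> by auto
  qed
  obtain R where R: "K \<subseteq> cball 0 R" using bounded_subset_ballD[OF compact_imp_bounded[OF K], of 0] ball_subset_cball by blast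
  define t where "t n = 1 / real (Suc n)" for n
  define q where "q n x = (F (x + t n *\<^sub>R b) - F x) / t n" for n x
  have t: "0 < t n" "t n \<le> 1" for n by (auto simp: t_def)
  have tr: "integrable lborel (\<lambda>x. F (x + t n *\<^sub>R b))"
    "integral\<^sup>L lborel (\<lambda>x. F (x + t n *\<^sub>R b)) = integral\<^sup>L lborel F" for n
  proof -
    have e: "lborel = distr lborel borel (\<lambda>x. t n *\<^sub>R b + x)"
      by (rule lborel_distr_plus[symmetric])
    have mF: "F \<in> borel_measurable borel" using iF by auto
    show "integrable lborel (\<lambda>x. F (x + t n *\<^sub>R b))"
      using iF e integrable_distr_eq[of "\<lambda>x. t n *\<^sub>R b + x" lborel borel F] mF
      by (simp add: add.commute)
    show "integral\<^sup>L lborel (\<lambda>x. F (x + t n *\<^sub>R b)) = integral\<^sup>L lborel F"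
      using e integral_distr[of "\<lambda>x. t n *\<^sub>R b + x" lborel borel F] mF
      by (simp add: add.commute)
  qed
  have q0: "integral\<^sup>L lborel (q n) = 0" for n
    unfolding q_def using tr iF by simp
  \<comment> \<open>The dominating function: the mean value theorem bounds the quotients by sup |D|,
    and since the step lengths are at most 1 they vanish outside the ball of radius R + |b|.\<close>
  have qb: "norm (q n x) \<le> indicator (cball 0 (R + norm b)) x *\<^sub>R C" for n x
  proof (cases "x \<in> cball 0 (R + norm b)")
    case True
    have "\<exists>\<xi>. \<xi> > 0 \<and> \<xi> < t n \<and> F (x + t n *\<^sub>R b) - F (x + 0 *\<^sub>R b) = (t n - 0) * D (x + \<xi> *\<^sub>R b)"
      by (rule MVT2[OF t(1)]) (rule has_dir_deriv_line[OF d'])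
    then obtain \<xi> where "F (x + t n *\<^sub>R b) - F (x + 0 *\<^sub>R b) = (t n - 0) * D (x + \<xi> *\<^sub>R b)"
      by auto
    then have "q n x = D (x + \<xi> *\<^sub>R b)" using t[of n] by (simp add: q_def field_simps)
    then show ?thesis using C True by simp
  next
    case False
    have "norm (t n *\<^sub>R b) \<le> norm b" using t[of n] by (simp add: mult_left_le_one_le)
    moreover have "norm x \<le> norm (x + t n *\<^sub>R b) + norm (t n *\<^sub>R b)"
      by (metis add_diff_cancel_right' norm_triangle_ineq4)
    moreover have "R + norm b < norm x" "0 \<le> norm b" using False by auto
    ultimately have "R < norm (x + t n *\<^sub>R b)" "R < norm x" by linarith+
    then have "x + t n *\<^sub>R b \<notin> cball 0 R" "x \<notin> cball 0 R" by auto
    then have "x + t n *\<^sub>R b \<notin> K" "x \<notin> K" using R by blast+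
    then have "q n x = 0" using F0 by (simp add: q_def)
    then show ?thesis using C by simp
  qed
  have lim: "(\<lambda>n. q n x) \<longlonglongrightarrow> D x" for x
  proof -
    have "((\<lambda>h. (F (x + h *\<^sub>R b) - F x) / h) \<longlongrightarrow> D x) (at 0)"
      using d'[of x] by (simp add: has_dir_deriv_def DERIV_def)
    moreover have "filterlim t (at 0) sequentially"
      using t LIMSEQ_inverse_real_of_nat by (simp add: filterlim_at t_def[abs_def] inverse_eq_divide)
    ultimately show ?thesis unfolding q_def by (rule filterlim_compose)
  qed
  have "(\<lambda>n. integral\<^sup>L lborel (q n)) \<longlonglongrightarrow> integral\<^sup>L lborel D"
  proof (rule integral_dominated_convergence)
    show "D \<in> borel_measurable lborel" using iD by auto
    show "q n \<in> borel_measurable lborel" for n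
      unfolding q_def using tr iF by auto
    show "integrable lborel (\<lambda>x. indicator (cball 0 (R + norm b)) x *\<^sub>R C)"
      by (rule borel_integrable_compact) auto
  qed (use lim qb in auto)
  then show ?thesis using q0 by (simp add: LIMSEQ_const_iff)
qed

text \<open>Only derivatives along the coordinate axes, and only the pure ones of second order, are recorded:
  \<open>h1 b\<close> and \<open>h2 b\<close> stand for $\partial_b h$ and $\partial_b^2 h$.\<close>

definition c1_on where
  "c1_on \<Omega> h h1 \<longleftrightarrow> continuous_on \<Omega> h \<and> (\<forall>b\<in>Basis. continuous_on \<Omega> (h1 b) \<and>
     (\<forall>x\<in>\<Omega>. has_dir_deriv h (h1 b x) b x))"

definition c2_on where
  "c2_on \<Omega> h h1 h2 \<longleftrightarrow> c1_on \<Omega> h h1 \<and> (\<forall>b\<in>Basis. continuous_on \<Omega> (h2 b) \<and>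
     (\<forall>x\<in>\<Omega>. has_dir_deriv (h1 b) (h2 b x) b x))"

text \<open>At points of K, also on its frontier, \<open>has_dir_deriv\<close> is the two-sided
  derivative along the whole line, so \<phi> meets its zero values outside K differentiably along
  the axes.\<close>

definition c1_supp where
  "c1_supp K \<phi> \<phi>1 \<longleftrightarrow> compact K \<and> c1_on K \<phi> \<phi>1 \<and>
     (\<forall>x. x \<notin> K \<longrightarrow> \<phi> x = 0 \<and> (\<forall>b\<in>Basis. \<phi>1 b x = 0))"

lemma c1_on_subset: "c1_on \<Omega> h h1 \<Longrightarrow> K \<subseteq> \<Omega> \<Longrightarrow> c1_on K h h1"
  unfolding c1_on_def by (blast intro: continuous_on_subset)

lemma c2_on_subset: "c2_on \<Omega> h h1 h2 \<Longrightarrow> K \<subseteq> \<Omega> \<Longrightarrow> c2_on K h h1 h2"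
  unfolding c2_on_def by (blast intro: continuous_on_subset c1_on_subset)

lemma c1_on_mult:
  assumes "c1_on \<Omega> f f1" "c1_on \<Omega> g g1"
  shows "c1_on \<Omega> (\<lambda>x. f x * g x) (\<lambda>b x. f1 b x * g x + f x * g1 b x)"
  using assms unfolding c1_on_def by (auto intro!: continuous_intros has_dir_deriv_mult)

lemma c1_on_compose:
  assumes "c1_on \<Omega> h h1" "\<And>t. t \<in> h ` \<Omega> \<Longrightarrow> (\<psi> has_real_derivative \<psi>1 t) (at t)"
    and "continuous_on (h ` \<Omega>) \<psi>1"
  shows "c1_on \<Omega> (\<lambda>x. \<psi> (h x)) (\<lambda>b x. \<psi>1 (h x) * h1 b x)"
proof -
  have "continuous_on (h ` \<Omega>) \<psi>"
    using assms(2) DERIV_isCont by (fastforce intro: continuous_at_imp_continuous_on)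
  then have "continuous_on \<Omega> (\<lambda>x. \<psi> (h x))"
    using assms(1) by (auto simp: c1_on_def intro: continuous_on_compose2)
  moreover have "continuous_on \<Omega> (\<lambda>x. \<psi>1 (h x))"
    using assms(1,3) by (auto simp: c1_on_def intro: continuous_on_compose2)
  moreover have "has_dir_deriv (\<lambda>x. \<psi> (h x)) (\<psi>1 (h x) * h1 b x) b x"
    if "b \<in> Basis" "x \<in> \<Omega>" for b x
    using that assms(1,2) by (intro has_dir_deriv_compose) (auto simp: c1_on_def)
  ultimately show ?thesis
    using assms(1) unfolding c1_on_def by (auto intro!: continuous_intros)
qed

lemma c1_supp_mult:
  assumes "c1_supp K \<phi> \<phi>1" "c1_on K g g1"
  shows "c1_supp K (\<lambda>x. \<phi> x * g x) (\<lambda>b x. \<phi>1 b x * g x + \<phi> x * g1 b x)"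
  using assms unfolding c1_supp_def by (auto intro: c1_on_mult)

lemma c2_on_diff:
  assumes "c2_on \<Omega> f f1 f2" "c2_on \<Omega> g g1 g2"
  shows "c2_on \<Omega> (\<lambda>x. f x - g x) (\<lambda>b x. f1 b x - g1 b x) (\<lambda>b x. f2 b x - g2 b x)"
  using assms unfolding c1_on_def c2_on_def by (auto intro!: continuous_intros has_dir_deriv_diff)

lemma c2_on_compose:
  assumes h: "c2_on \<Omega> h h1 h2" and "\<And>t. t \<in> h ` \<Omega> \<Longrightarrow> (\<psi> has_real_derivative \<psi>1 t) (at t)"
    and "\<And>t. t \<in> h ` \<Omega> \<Longrightarrow> (\<psi>1 has_real_derivative \<psi>2 t) (at t)"
    and "continuous_on (h ` \<Omega>) \<psi>2"
  shows "c2_on \<Omega> (\<lambda>x. \<psi> (h x)) (\<lambda>b x. \<psi>1 (h x) * h1 b x)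
    (\<lambda>b x. \<psi>2 (h x) * (h1 b x)\<^sup>2 + \<psi>1 (h x) * h2 b x)"
proof -
  have c: "continuous_on (h ` \<Omega>) \<psi>1"
    using assms(3) DERIV_isCont by (fastforce intro: continuous_at_imp_continuous_on)
  have h1: "c1_on \<Omega> h h1" using h by (simp add: c2_on_def)
  have 1: "c1_on \<Omega> (\<lambda>x. \<psi> (h x)) (\<lambda>b x. \<psi>1 (h x) * h1 b x)"
    by (rule c1_on_compose[OF h1 assms(2) c])
  have 2: "c1_on \<Omega> (\<lambda>x. \<psi>1 (h x)) (\<lambda>b x. \<psi>2 (h x) * h1 b x)"
    by (rule c1_on_compose[OF h1 assms(3,4)])
  have 3: "has_dir_deriv (\<lambda>x. \<psi>1 (h x) * h1 b x)
     (\<psi>2 (h x) * (h1 b x)\<^sup>2 + \<psi>1 (h x) * h2 b x) b x" if "b \<in> Basis" "x \<in> \<Omega>" for b x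
    using has_dir_deriv_mult[of "\<lambda>x. \<psi>1 (h x)" "\<psi>2 (h x) * h1 b x" b x "h1 b" "h2 b x"]
      2 h that by (auto simp: c1_on_def c2_on_def power2_eq_square mult.assoc)
  have "continuous_on \<Omega> (\<lambda>x. \<psi>2 (h x))" "continuous_on \<Omega> (\<lambda>x. \<psi>1 (h x))"
    using h1 assms(4) c by (auto simp: c1_on_def intro: continuous_on_compose2)
  then show ?thesis
    using 1 3 h unfolding c2_on_def c1_on_def by (auto intro!: continuous_intros)
qed

text \<open>Each product of \<phi> with \<open>h1 b\<close> vanishes off K, so its derivative along
  b has integral 0; summing over the axes gives Green's formula without a boundary term. Regularity
  of h is asked on K alone, which admits functions known only inside the domain.\<close>

lemma integral_by_parts_laplacian:
  fixes \<phi> :: "'a::euclidean_space \<Rightarrow> real"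
  assumes \<phi>: "c1_supp K \<phi> \<phi>1" and h: "c2_on K h h1 h2"
  shows "integrable lborel (\<lambda>x. \<phi> x * (\<Sum>b\<in>Basis. h2 b x))"
    and "integrable lborel (\<lambda>x. \<Sum>b\<in>Basis. \<phi>1 b x * h1 b x)"
    and "(\<integral>x. \<phi> x * (\<Sum>b\<in>Basis. h2 b x) \<partial>lborel) =
         - (\<integral>x. (\<Sum>b\<in>Basis. \<phi>1 b x * h1 b x) \<partial>lborel)"
proof -
  note d = \<phi>[unfolded c1_supp_def c1_on_def] h[unfolded c2_on_def c1_on_def]
  have K: "compact K" using d by simp
  show 1: "integrable lborel (\<lambda>x. \<phi> x * (\<Sum>b\<in>Basis. h2 b x))"
    using d by (intro integrable_compact_support[OF K]) (auto intro!: continuous_intros)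
  show 2: "integrable lborel (\<lambda>x. \<Sum>b\<in>Basis. \<phi>1 b x * h1 b x)"
    using d by (intro integrable_compact_support[OF K]) (auto intro!: continuous_intros)
  have i: "integrable lborel (\<lambda>x. \<phi>1 b x * h1 b x + \<phi> x * h2 b x)" if "b \<in> Basis" for b
    using d that by (intro integrable_compact_support[OF K]) (auto intro!: continuous_intros)
  have z: "(\<integral>x. \<phi>1 b x * h1 b x + \<phi> x * h2 b x \<partial>lborel) = 0" if "b \<in> Basis" for b
    by (rule integral_dir_deriv_eq_0[OF K, of "\<lambda>x. \<phi> x * h1 b x" _ b])
      (use d that in \<open>auto intro!: continuous_intros has_dir_deriv_mult\<close>)
  have "(\<integral>x. \<phi> x * (\<Sum>b\<in>Basis. h2 b x) \<partial>lborel) + (\<integral>x. (\<Sum>b\<in>Basis. \<phi>1 b x * h1 b x) \<partial>lborel)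
      = (\<integral>x. (\<Sum>b\<in>Basis. \<phi>1 b x * h1 b x + \<phi> x * h2 b x) \<partial>lborel)"
    using 1 2 by (simp add: sum.distrib sum_distrib_left add.commute
        flip: Bochner_Integration.integral_add)
  also have "\<dots> = (\<Sum>b\<in>Basis. (\<integral>x. \<phi>1 b x * h1 b x + \<phi> x * h2 b x \<partial>lborel))"
    using i by (rule Bochner_Integration.integral_sum)
  also have "\<dots> = 0" using z by simp
  finally show "(\<integral>x. \<phi> x * (\<Sum>b\<in>Basis. h2 b x) \<partial>lborel) =
         - (\<integral>x. (\<Sum>b\<in>Basis. \<phi>1 b x * h1 b x) \<partial>lborel)" by simp
qed

section \<open>Picone inequalities and the linearised system\<close>

lemma picone:
  fixes \<phi> :: "'a::euclidean_space \<Rightarrow> real"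
  assumes \<phi>: "c1_supp K \<phi> \<phi>1" and Q: "c2_on K Q Q1 Q2" and pos: "\<And>x. x \<in> K \<Longrightarrow> 0 < Q x"
  shows "integrable lborel (\<lambda>x. (\<phi> x)\<^sup>2 * (- (\<Sum>b\<in>Basis. Q2 b x) / Q x))"
    and "integrable lborel (\<lambda>x. \<Sum>b\<in>Basis. (\<phi>1 b x)\<^sup>2)"
    and "(\<integral>x. (\<phi> x)\<^sup>2 * (- (\<Sum>b\<in>Basis. Q2 b x) / Q x) \<partial>lborel) \<le>
         (\<integral>x. (\<Sum>b\<in>Basis. (\<phi>1 b x)\<^sup>2) \<partial>lborel)"
proof -
  have K: "compact K" using \<phi> by (simp add: c1_supp_def)
  have Q': "c1_on K Q Q1" using Q by (simp add: c2_on_def)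
  \<comment> \<open>The test function \<phi>^2/Q, associated so that \<open>c1_supp_mult\<close> and
    \<open>c1_on_mult\<close> apply.\<close>
  define \<psi> where "\<psi> x = \<phi> x * (\<phi> x * inverse (Q x))" for x
  define \<psi>1 where "\<psi>1 b x = \<phi>1 b x * (\<phi> x * inverse (Q x)) +
    \<phi> x * (\<phi>1 b x * inverse (Q x) + \<phi> x * (- (inverse (Q x) ^ 2) * Q1 b x))" for b x
  have i: "c1_on K (\<lambda>x. inverse (Q x)) (\<lambda>b x. - (inverse (Q x) ^ 2) * Q1 b x)"
    using pos by (intro c1_on_compose[OF Q'])
      (force intro!: derivative_eq_intros continuous_intros simp: power2_eq_square)+
  have "c1_on K \<phi> \<phi>1" using \<phi> by (simp add: c1_supp_def)
  then have \<psi>: "c1_supp K \<psi> \<psi>1"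
    unfolding \<psi>_def \<psi>1_def by (intro c1_supp_mult[OF \<phi>] c1_on_mult i)
  note p = integral_by_parts_laplacian[OF \<psi> Q]
  have e1: "(\<phi> x)\<^sup>2 * (- (\<Sum>b\<in>Basis. Q2 b x) / Q x) = - (\<psi> x * (\<Sum>b\<in>Basis. Q2 b x))" for x
    by (simp add: \<psi>_def divide_inverse power2_eq_square)
  show "integrable lborel (\<lambda>x. (\<phi> x)\<^sup>2 * (- (\<Sum>b\<in>Basis. Q2 b x) / Q x))"
    unfolding e1 using p(1) by simp
  show i2: "integrable lborel (\<lambda>x. \<Sum>b\<in>Basis. (\<phi>1 b x)\<^sup>2)"
    using \<phi> by (intro integrable_compact_support[OF K])
      (auto intro!: continuous_intros simp: c1_supp_def c1_on_def)
  \<comment> \<open>Picone's identity in one coordinate: the difference of the two sides is a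
    complete square.\<close>
  have "\<psi>1 b x * Q1 b x \<le> (\<phi>1 b x)\<^sup>2" if "b \<in> Basis" for b x
  proof (cases "x \<in> K")
    case True
    have "(\<phi>1 b x)\<^sup>2 - \<psi>1 b x * Q1 b x = (\<phi>1 b x - \<phi> x * inverse (Q x) * Q1 b x)\<^sup>2"
      unfolding \<psi>1_def by (simp add: power2_eq_square algebra_simps)
    then show ?thesis by (metis diff_ge_0_iff_ge zero_le_power2)
  next
    case False
    then show ?thesis using \<psi> that by (simp add: c1_supp_def)
  qed
  then have "(\<integral>x. (\<Sum>b\<in>Basis. \<psi>1 b x * Q1 b x) \<partial>lborel) \<le> (\<integral>x. (\<Sum>b\<in>Basis. (\<phi>1 b x)\<^sup>2) \<partial>lborel)"
    by (intro integral_mono p(2) i2 sum_mono)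
  then show "(\<integral>x. (\<phi> x)\<^sup>2 * (- (\<Sum>b\<in>Basis. Q2 b x) / Q x) \<partial>lborel) \<le>
         (\<integral>x. (\<Sum>b\<in>Basis. (\<phi>1 b x)\<^sup>2) \<partial>lborel)"
    unfolding e1 using p(3) by simp
qed

text \<open>Adding the Picone inequalities of D and z for the same \<phi> leaves z/D + gD/z >= 2
  sqrt g under the integral, by the arithmetic-geometric mean. Since z may vanish it is replaced by
  z + d; the equation for D then costs an error d/D, which is made small by d.\<close>

lemma stability_inequality:
  fixes \<phi> :: "'a::euclidean_space \<Rightarrow> real"
  assumes \<phi>: "c1_supp K \<phi> \<phi>1" and D: "c2_on K D D1 D2" and z: "c2_on K z z1 z2"
    and pos: "\<And>x. x \<in> K \<Longrightarrow> 0 < D x" "\<And>x. x \<in> K \<Longrightarrow> 0 \<le> z x" "\<And>x. x \<in> K \<Longrightarrow> 0 \<le> g x"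
    and cg: "continuous_on K g"
    and lD: "\<And>x. x \<in> K \<Longrightarrow> (\<Sum>b\<in>Basis. D2 b x) = - z x"
    and lz: "\<And>x. x \<in> K \<Longrightarrow> (\<Sum>b\<in>Basis. z2 b x) \<le> - (g x * D x)"
  shows "(\<integral>x. sqrt (g x) * (\<phi> x)\<^sup>2 \<partial>lborel) \<le> (\<integral>x. (\<Sum>b\<in>Basis. (\<phi>1 b x)\<^sup>2) \<partial>lborel)"
proof (rule field_le_epsilon)
  fix e :: real assume e: "0 < e"
  have K: "compact K" using \<phi> by (simp add: c1_supp_def)
  have c: "continuous_on K \<phi>" "continuous_on K D" and \<phi>0: "\<And>x. x \<notin> K \<Longrightarrow> \<phi> x = 0"
    using \<phi> D by (auto simp: c1_supp_def c1_on_def c2_on_def)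
  define C where "C = (\<integral>x. (\<phi> x)\<^sup>2 / D x \<partial>lborel)"
  have iC: "integrable lborel (\<lambda>x. (\<phi> x)\<^sup>2 / D x)"
    using pos(1) \<phi>0 c by (intro integrable_compact_support[OF K])
      (force intro!: continuous_intros)+
  have ig: "integrable lborel (\<lambda>x. sqrt (g x) * (\<phi> x)\<^sup>2)"
    using \<phi>0 c cg by (intro integrable_compact_support[OF K]) (auto intro!: continuous_intros)
  have C0: "C \<ge> 0" unfolding C_def
    by (rule integral_nonneg_AE) (use pos(1) \<phi>0 in \<open>auto intro!: AE_I2 simp: less_le split: prod.splits\<close>,
      metis divide_nonneg_pos div_0 less_le zero_le_power2 zero_power2)
  \<comment> \<open>The shift costs d times the integral C of \<phi>^2/D; the + 1 covers C =
    0.\<close>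
  define d where "d = e / (C + 1)"
  have d: "d > 0" "d * C \<le> e" using e C0 by (auto simp: d_def field_simps)
  let ?z = "\<lambda>x. z x + d"
  have z': "c2_on K ?z z1 z2"
    using z unfolding c2_on_def c1_on_def
    by (auto intro!: continuous_intros) (use has_dir_deriv_add[OF _ has_dir_deriv_const] in fastforce)
  have zp: "0 < ?z x" if "x \<in> K" for x using pos(2)[OF that] d by simp
  have idC: "integrable lborel (\<lambda>x. d * ((\<phi> x)\<^sup>2 / D x))"
    using iC by (intro integrable_mult_right)
  note p = picone[OF \<phi> D pos(1)] and q = picone[OF \<phi> z' zp]
  let ?R = "\<lambda>x. (\<phi> x)\<^sup>2 * (- (\<Sum>b\<in>Basis. D2 b x) / D x) + (\<phi> x)\<^sup>2 * (- (\<Sum>b\<in>Basis. z2 b x) / ?z x)"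
  have pw: "2 * (sqrt (g x) * (\<phi> x)\<^sup>2) \<le> ?R x + d * ((\<phi> x)\<^sup>2 / D x)" for x
  proof (cases "x \<in> K")
    case True
    have Dx: "D x > 0" and Zx: "?z x > 0" using pos True zp by auto
    have "2 * sqrt (g x) \<le> ?z x / D x + g x * D x / ?z x"
    proof -
      define r where "r = D x / ?z x"
      have r: "r > 0" using Dx Zx by (simp add: r_def)
      have "0 \<le> (sqrt (g x) * r - 1)\<^sup>2" by simp
      then have "2 * sqrt (g x) * r \<le> g x * r\<^sup>2 + 1"
        using pos(3)[OF True] by (simp add: power2_eq_square algebra_simps)
      then have "2 * sqrt (g x) \<le> (g x * r\<^sup>2 + 1) / r" using r by (simp add: pos_le_divide_eq)
      also have "\<dots> = 1 / r + g x * r" using r by (simp add: field_simps power2_eq_square)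
      finally show ?thesis by (simp add: r_def)
    qed
    also have "g x * D x / ?z x \<le> - (\<Sum>b\<in>Basis. z2 b x) / ?z x"
      using lz[OF True] Zx by (intro divide_right_mono) auto
    also have "?z x / D x = - (\<Sum>b\<in>Basis. D2 b x) / D x + d / D x"
      using lD[OF True] by (simp add: add_divide_distrib)
    finally have "(\<phi> x)\<^sup>2 * (2 * sqrt (g x)) \<le> (\<phi> x)\<^sup>2 *
        (- (\<Sum>b\<in>Basis. D2 b x) / D x + d / D x + - (\<Sum>b\<in>Basis. z2 b x) / ?z x)"
      by (intro mult_left_mono) auto
    then show ?thesis by (simp add: algebra_simps)
  qed (use \<phi>0 in auto)
  have "2 * (\<integral>x. sqrt (g x) * (\<phi> x)\<^sup>2 \<partial>lborel) = (\<integral>x. 2 * (sqrt (g x) * (\<phi> x)\<^sup>2) \<partial>lborel)" by simp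
  also have "\<dots> \<le> (\<integral>x. ?R x + d * ((\<phi> x)\<^sup>2 / D x) \<partial>lborel)"
    by (intro integral_mono Bochner_Integration.integrable_add integrable_mult_right ig iC p(1) q(1) pw)
  also have "\<dots> = (\<integral>x. (\<phi> x)\<^sup>2 * (- (\<Sum>b\<in>Basis. D2 b x) / D x) \<partial>lborel) +
      (\<integral>x. (\<phi> x)\<^sup>2 * (- (\<Sum>b\<in>Basis. z2 b x) / ?z x) \<partial>lborel) + d * C"
    unfolding C_def
    by (simp only: Bochner_Integration.integral_add[OF Bochner_Integration.integrable_add[OF p(1) q(1)] idC]
        Bochner_Integration.integral_add[OF p(1) q(1)] integral_mult_right_zero)
  finally show "(\<integral>x. sqrt (g x) * (\<phi> x)\<^sup>2 \<partial>lborel) \<le> (\<integral>x. (\<Sum>b\<in>Basis. (\<phi>1 b x)\<^sup>2) \<partial>lborel) + e"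
    using p(3) q(3) d e by linarith
qed

section \<open>The maximum principle\<close>

lemma laplacian_nonneg_at_minimum:
  fixes h :: "'a::euclidean_space \<Rightarrow> real"
  assumes "open \<Omega>" "c2_on \<Omega> h h1 h2" "x \<in> \<Omega>" "\<And>y. y \<in> \<Omega> \<Longrightarrow> h x \<le> h y"
  shows "0 \<le> (\<Sum>b\<in>Basis. h2 b x)"
proof (rule sum_nonneg)
  fix b :: 'a assume b: "b \<in> Basis"
  obtain r where r: "r > 0" "ball x r \<subseteq> \<Omega>" using assms(1,3) by (meson openE)
  have in_\<Omega>: "x + t *\<^sub>R b \<in> \<Omega>" if "\<bar>t\<bar> < r" for t
    using r b that by (auto simp: dist_norm subset_iff)
  let ?g = "\<lambda>t. h (x + t *\<^sub>R b)" and ?g1 = "\<lambda>t. h1 b (x + t *\<^sub>R b)"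
  have g: "(?g has_real_derivative ?g1 t) (at t)" if "\<bar>t\<bar> < r" for t
    by (rule has_dir_deriv_line) (use assms(2) b in_\<Omega>[OF that] in \<open>auto simp: c2_on_def c1_on_def\<close>)
  have g2: "(?g1 has_real_derivative h2 b x) (at 0)"
    using assms(2,3) b by (auto simp: c2_on_def has_dir_deriv_def)
  have z: "?g1 0 = 0"
    by (rule DERIV_local_min[OF g[of 0] r(1)]) (use r in_\<Omega> assms(4) in auto)
  show "0 \<le> h2 b x"
  proof (rule ccontr)
    assume "\<not> 0 \<le> h2 b x"
    then obtain d where d: "d > 0" "\<And>t. 0 < t \<Longrightarrow> t < d \<Longrightarrow> ?g1 t < 0"
      using DERIV_neg_dec_right[OF g2] z by auto
    define t where "t = min r d / 2"
    have t: "0 < t" "t < r" "t < d" using r d by (auto simp: t_def)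
    have "\<exists>\<xi>. \<xi> > 0 \<and> \<xi> < t \<and> ?g t - ?g 0 = (t - 0) * ?g1 \<xi>"
      by (rule MVT2[OF t(1)]) (use g t in auto)
    then obtain \<xi> where "0 < \<xi>" "\<xi> < t" "?g t - ?g 0 = t * ?g1 \<xi>" by auto
    moreover have "t * ?g1 \<xi> < 0" using d(2)[of \<xi>] t calculation(1,2) by (intro mult_pos_neg) auto
    moreover have "?g 0 \<le> ?g t" using assms(4) in_\<Omega>[of t] t by simp
    ultimately show False by linarith
  qed
qed

text \<open>At a negative interior minimum the Laplacian would be nonnegative. Its sign is asked
  only where h < 0: in the comparison of v with a function of u it is known only there.\<close>

lemma minimum_principle_strict:
  fixes h :: "'a::euclidean_space \<Rightarrow> real"
  assumes "open \<Omega>" "bounded \<Omega>" "c2_on \<Omega> h h1 h2" "continuous_on (closure \<Omega>) h"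
    and bd: "\<And>x. x \<in> frontier \<Omega> \<Longrightarrow> 0 \<le> h x"
    and sup: "\<And>x. x \<in> \<Omega> \<Longrightarrow> h x < 0 \<Longrightarrow> (\<Sum>b\<in>Basis. h2 b x) < 0"
    and "y \<in> \<Omega>"
  shows "0 \<le> h y"
proof (rule ccontr)
  assume "\<not> 0 \<le> h y"
  have "compact (closure \<Omega>)" "closure \<Omega> \<noteq> {}" using assms(2,7) by auto
  then obtain x where x: "x \<in> closure \<Omega>" "\<And>z. z \<in> closure \<Omega> \<Longrightarrow> h x \<le> h z"
    using continuous_attains_inf[OF _ _ assms(4)] by blast
  have "y \<in> closure \<Omega>" using assms(7) closure_subset by blast
  then have "h x < 0" using x(2)[of y] \<open>\<not> 0 \<le> h y\<close> by simp
  then have "x \<in> \<Omega>" using bd[of x] x(1) assms(1) by (auto simp: frontier_def interior_open)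
  then have "0 \<le> (\<Sum>b\<in>Basis. h2 b x)"
    using laplacian_nonneg_at_minimum[OF assms(1,3)] x(2) closure_subset by blast
  then show False using sup[OF \<open>x \<in> \<Omega>\<close> \<open>h x < 0\<close>] by simp
qed

lemma has_dir_deriv_inner:
  "has_dir_deriv (\<lambda>y. (y - a) \<bullet> c) (b \<bullet> c) b x"
  unfolding has_dir_deriv_def
  by (auto intro!: derivative_eq_intros simp: inner_diff_left inner_add_left)

lemma has_dir_deriv_norm_square:
  "has_dir_deriv (\<lambda>y. (y - a) \<bullet> (y - a)) (2 * ((x - a) \<bullet> b)) b x"
proof -
  have "(\<lambda>t. (x + t *\<^sub>R b - a) \<bullet> (x + t *\<^sub>R b - a)) =
      (\<lambda>t. (x - a) \<bullet> (x - a) + 2 * t * ((x - a) \<bullet> b) + t\<^sup>2 * (b \<bullet> b))"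
    by (simp add: fun_eq_iff algebra_simps inner_commute power2_eq_square)
  then show ?thesis unfolding has_dir_deriv_def by (auto intro!: derivative_eq_intros)
qed

lemma c2_on_norm_square:
  fixes a :: "'a::euclidean_space"
  shows "c2_on \<Omega> (\<lambda>y. (y - a) \<bullet> (y - a)) (\<lambda>b y. 2 * ((y - a) \<bullet> b)) (\<lambda>b y. 2)"
proof -
  have "has_dir_deriv (\<lambda>y. 2 * ((y - a) \<bullet> b)) 2 b x" if "b \<in> Basis" for b x :: 'a
    using has_dir_deriv_mult[OF has_dir_deriv_const[of 2] has_dir_deriv_inner[of a b b x]] that by simp
  then show ?thesis
    unfolding c2_on_def c1_on_def by (auto intro!: continuous_intros has_dir_deriv_norm_square)
qed

text \<open>Subtracting d(|y|^2 - R^2) makes the Laplacian strictly negative; the subtracted term is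
  nonpositive on the closure, so the boundary inequality survives.\<close>

lemma minimum_principle:
  fixes h :: "'a::euclidean_space \<Rightarrow> real"
  assumes "open \<Omega>" "bounded \<Omega>" "c2_on \<Omega> h h1 h2" "continuous_on (closure \<Omega>) h"
    and bd: "\<And>x. x \<in> frontier \<Omega> \<Longrightarrow> 0 \<le> h x"
    and sup: "\<And>x. x \<in> \<Omega> \<Longrightarrow> (\<Sum>b\<in>Basis. h2 b x) \<le> 0"
    and y: "y \<in> \<Omega>"
  shows "0 \<le> h y"
proof (rule field_le_epsilon)
  fix e :: real assume e: "0 < e"
  obtain R where R: "R > 0" "\<And>x. x \<in> closure \<Omega> \<Longrightarrow> norm x \<le> R"
    using bounded_closure[OF assms(2)] by (auto simp: bounded_pos)
  have R2: "x \<bullet> x \<le> R\<^sup>2" if "x \<in> closure \<Omega>" for x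
    using R(2)[OF that] R(1) by (simp add: dot_square_norm power_mono)
  \<comment> \<open>Scaled so that the perturbation raises h by at most e.\<close>
  define d where "d = e / R\<^sup>2"
  have d: "d > 0" "d * R\<^sup>2 = e" using e R by (auto simp: d_def)
  have q: "c2_on \<Omega> (\<lambda>y. d * (y \<bullet> y - R\<^sup>2)) (\<lambda>b y. d * (2 * (y \<bullet> b))) (\<lambda>b y. 0 * (2 * (y \<bullet> b))\<^sup>2 + d * 2)"
  proof (rule c2_on_compose[where ?h = "\<lambda>y. y \<bullet> y" and ?\<psi> = "\<lambda>t. d * (t - R\<^sup>2)" and ?\<psi>1.0 = "\<lambda>t. d" and ?\<psi>2.0 = "\<lambda>t. 0"])
    show "c2_on \<Omega> (\<lambda>y. y \<bullet> y) (\<lambda>b y. 2 * (y \<bullet> b)) (\<lambda>b y. 2)"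
      using c2_on_norm_square[of \<Omega> 0] by simp
    show "((\<lambda>t. d * (t - R\<^sup>2)) has_real_derivative d) (at t)" for t
      by (auto intro!: derivative_eq_intros)
  qed auto
  have "0 \<le> h y - d * (y \<bullet> y - R\<^sup>2)"
  proof (rule minimum_principle_strict[OF assms(1,2) c2_on_diff[OF assms(3) q] _ _ _ y])
    show "continuous_on (closure \<Omega>) (\<lambda>x. h x - d * (x \<bullet> x - R\<^sup>2))"
      using assms(4) by (intro continuous_intros)
    show "0 \<le> h x - d * (x \<bullet> x - R\<^sup>2)" if "x \<in> frontier \<Omega>" for x
    proof -
      have "x \<in> closure \<Omega>" using that by (simp add: frontier_def)
      then have "d * (x \<bullet> x - R\<^sup>2) \<le> 0" using d R2[of x] by (simp add: mult_le_0_iff)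
      then show ?thesis using bd[OF that] by simp
    qed
    show "(\<Sum>b\<in>Basis. h2 b x - (0 * (2 * (x \<bullet> b))\<^sup>2 + d * 2)) < 0" if "x \<in> \<Omega>" for x
    proof -
      have "0 < real DIM('a) * (d * 2)" using d by simp
      moreover have "(\<Sum>b\<in>Basis. h2 b x - (0 * (2 * (x \<bullet> b))\<^sup>2 + d * 2)) =
          (\<Sum>b\<in>Basis. h2 b x) - real DIM('a) * (d * 2)" by (simp add: sum_subtractf)
      ultimately show ?thesis using sup[OF that] by linarith
    qed
  qed
  also have "\<dots> \<le> h y + e" using d by (simp add: algebra_simps)
  finally show "0 \<le> h y + e" .
qed

text \<open>The fourth order problem as the system $-\Delta u = v$, $-\Delta v = \lambda (u+1)^p$, with both
  functions extended by \<open>0\<close> outside \<open>\<Omega>\<close>.\<close>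

locale navier_system =
  fixes \<Omega> :: "'a::euclidean_space set" and p l :: real and u v :: "'a \<Rightarrow> real"
    and u1 u2 v1 v2 :: "'a \<Rightarrow> 'a \<Rightarrow> real"
  assumes open_domain: "open \<Omega>" and bounded_domain: "bounded \<Omega>"
    and p: "1 < p" and l: "0 < l"
    and continuous: "continuous_on UNIV u" "continuous_on UNIV v"
    and outside: "\<And>x. x \<notin> \<Omega> \<Longrightarrow> u x = 0" "\<And>x. x \<notin> \<Omega> \<Longrightarrow> v x = 0"
    and c2: "c2_on \<Omega> u u1 u2" "c2_on \<Omega> v v1 v2"
    and eq_u: "\<And>x. x \<in> \<Omega> \<Longrightarrow> (\<Sum>b\<in>Basis. u2 b x) = - v x"
    and eq_v: "\<And>x. x \<in> \<Omega> \<Longrightarrow> (\<Sum>b\<in>Basis. v2 b x) = - (l * (u x + 1) powr p)"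
begin

lemma frontier_outside: "x \<in> frontier \<Omega> \<Longrightarrow> x \<notin> \<Omega>"
  using open_domain by (simp add: frontier_def interior_open)

text \<open>\<open>powr\<close> never takes negative values, so v is superharmonic whatever the sign
  of u + 1. This settles v before u, whose sign then follows from that of v.\<close>

lemma v_nonneg: "0 \<le> v x"
proof (cases "x \<in> \<Omega>")
  case True
  show ?thesis
    by (rule minimum_principle[OF open_domain bounded_domain c2(2) _ _ _ True])
      (use continuous outside frontier_outside eq_v l in \<open>auto intro: continuous_on_subset\<close>)
qed (use outside in simp)

lemma u_nonneg: "0 \<le> u x"
proof (cases "x \<in> \<Omega>")
  case True
  show ?thesis
    by (rule minimum_principle[OF open_domain bounded_domain c2(1) _ _ _ True])
      (use continuous outside frontier_outside eq_u v_nonneg in \<open>auto intro: continuous_on_subset\<close>)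
qed (use outside in simp)

text \<open>Let \<eta>(u) = c((u+1)^k - 1) with k = (p+1)/2. As \<eta> is convex and increasing,
  wherever v < \<eta>(u) the Laplacian of v - \<eta>(u) is less than -l(u+1)^p + \<eta>'(u)
  \<eta>(u). The choices 2k - 1 = p and c^2 k = l make this at most 0, and \<eta>(0) = 0 fits the
  boundary values.\<close>

lemma comparison:
  "(u x + 1) powr ((p + 1) / 2) \<le> sqrt ((p + 1) / (2 * l)) * v x + 1"
proof -
  define c where "c = sqrt (2 * l / (p + 1))"
  define k where "k = (p + 1) / 2"
  have c: "c > 0" "c\<^sup>2 * k = l" using p l by (auto simp: c_def k_def)
  have k: "k > 1" using p by (simp add: k_def)
  define \<eta> where "\<eta> t = c * ((t + 1) powr k - 1)" for t
  define \<eta>1 where "\<eta>1 t = c * (k * (t + 1) powr (k - 1))" for t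
  define \<eta>2 where "\<eta>2 t = c * (k * ((k - 1) * (t + 1) powr (k - 2)))" for t
  have d: "(\<eta> has_real_derivative \<eta>1 t) (at t)" "(\<eta>1 has_real_derivative \<eta>2 t) (at t)"
    if "t \<in> u ` \<Omega>" for t
  proof -
    have "t + 1 > 0" using that u_nonneg by (auto simp: add_nonneg_pos)
    then show "(\<eta> has_real_derivative \<eta>1 t) (at t)" "(\<eta>1 has_real_derivative \<eta>2 t) (at t)"
      unfolding \<eta>_def[abs_def] \<eta>1_def[abs_def] \<eta>2_def
      by (auto intro!: derivative_eq_intros simp: mult_ac)
  qed
  have "continuous_on (u ` \<Omega>) \<eta>2"
    unfolding \<eta>2_def[abs_def] using u_nonneg
    by (intro continuous_intros) (auto, smt (verit) u_nonneg)
  note cc = c2_on_compose[OF c2(1) d this]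
  have "\<eta> (u x) \<le> v x"
  proof (cases "x \<in> \<Omega>")
    case True
    have "0 \<le> v x - \<eta> (u x)"
    proof (rule minimum_principle_strict[OF open_domain bounded_domain c2_on_diff[OF c2(2) cc] _ _ _ True])
      have "continuous_on UNIV (\<lambda>x. \<eta> (u x))"
        unfolding \<eta>_def using continuous u_nonneg
        by (intro continuous_intros) (auto, smt (verit) u_nonneg)
      then show "continuous_on (closure \<Omega>) (\<lambda>x. v x - \<eta> (u x))"
        using continuous by (auto intro!: continuous_intros intro: continuous_on_subset)
      show "0 \<le> v x - \<eta> (u x)" if "x \<in> frontier \<Omega>" for x
        using frontier_outside[OF that] outside by (simp add: \<eta>_def)
      show "(\<Sum>b\<in>Basis. v2 b x - (\<eta>2 (u x) * (u1 b x)\<^sup>2 + \<eta>1 (u x) * u2 b x)) < 0"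
        if "x \<in> \<Omega>" and neg: "v x - \<eta> (u x) < 0" for x
      proof -
        have s: "u x + 1 > 0" using u_nonneg[of x] by simp
        have \<eta>1: "\<eta>1 (u x) > 0" using s c k by (simp add: \<eta>1_def)
        have \<eta>2: "\<eta>2 (u x) \<ge> 0" using s c k by (simp add: \<eta>2_def)
        have "(\<Sum>b\<in>Basis. v2 b x - (\<eta>2 (u x) * (u1 b x)\<^sup>2 + \<eta>1 (u x) * u2 b x))
          = (\<Sum>b\<in>Basis. v2 b x) - \<eta>2 (u x) * (\<Sum>b\<in>Basis. (u1 b x)\<^sup>2) - \<eta>1 (u x) * (\<Sum>b\<in>Basis. u2 b x)"
          by (simp add: sum_subtractf sum.distrib sum_distrib_left)
        also have "\<dots> \<le> - (l * (u x + 1) powr p) + \<eta>1 (u x) * v x"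
          using eq_u[OF that(1)] eq_v[OF that(1)] \<eta>2 by (simp add: sum_nonneg)
        also have "\<dots> < - (l * (u x + 1) powr p) + \<eta>1 (u x) * \<eta> (u x)"
          using \<eta>1 neg by simp
        also have "\<eta>1 (u x) * \<eta> (u x) = c\<^sup>2 * k * ((u x + 1) powr (k - 1) * ((u x + 1) powr k - 1))"
          by (simp add: \<eta>1_def \<eta>_def power2_eq_square)
        also have "\<dots> \<le> l * ((u x + 1) powr (k - 1) * (u x + 1) powr k)"
          using c l by (auto intro!: mult_left_mono)
        also have "(u x + 1) powr (k - 1) * (u x + 1) powr k = (u x + 1) powr p"
          by (simp add: k_def flip: powr_add) (simp add: field_simps)
        finally show ?thesis by simp
      qed
    qed
    then show ?thesis by simp
  qed (use outside in \<open>simp add: \<eta>_def\<close>)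
  then have "(u x + 1) powr k \<le> (1 / c) * v x + 1"
    using c by (simp add: \<eta>_def field_simps)
  also have "1 / c = sqrt ((p + 1) / (2 * l))"
    using p l by (simp add: c_def real_sqrt_divide)
  finally show ?thesis by (simp add: k_def)
qed
end

text \<open>Boundary values are given only as limits from inside. At a point outside \<Omega> the
  limits along \<Omega> and along its complement are both 0.\<close>

lemma continuous_on_zero_extension:
  fixes h :: "'a::euclidean_space \<Rightarrow> real"
  assumes "open \<Omega>" "continuous_on \<Omega> h" "\<And>y. y \<in> frontier \<Omega> \<Longrightarrow> (h \<longlongrightarrow> 0) (at y within \<Omega>)"
  shows "continuous_on UNIV (\<lambda>x. if x \<in> \<Omega> then h x else 0)" (is "continuous_on UNIV ?h")
proof -
  have "(?h \<longlongrightarrow> ?h x) (at x)" for x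
  proof (cases "x \<in> \<Omega>")
    case True
    have "continuous_on \<Omega> ?h" using assms(2) by (rule continuous_on_eq) auto
    then have "isCont ?h x" using True continuous_on_eq_continuous_at[OF assms(1)] by blast
    then show ?thesis unfolding isCont_def .
  next
    case False
    have "(?h \<longlongrightarrow> 0) (at x within - \<Omega>)"
      by (rule Lim_transform_eventually[OF tendsto_const[of 0]]) (auto simp: eventually_at_filter)
    moreover have "(?h \<longlongrightarrow> 0) (at x within \<Omega>)"
    proof (cases "x \<in> closure \<Omega>")
      case True
      then have "x \<in> frontier \<Omega>" using False assms(1) by (simp add: frontier_def interior_open)
      from assms(3)[OF this] show ?thesis
        by (rule Lim_transform_eventually) (auto simp: eventually_at_filter)
    next
      case False
      then have "at x within \<Omega> = bot"
        using trivial_limit_within[of x \<Omega>] islimpt_in_closure[of x \<Omega>] closure_mono[of "\<Omega> - {x}" \<Omega>] by auto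
      then show ?thesis by simp
    qed
    ultimately have "(?h \<longlongrightarrow> 0) (at x)" using Lim_Un_univ by blast
    then show ?thesis using False by simp
  qed
  then show ?thesis by (simp add: continuous_on_def)
qed

section \<open>Semistability and energy estimates\<close>

text \<open>Only the kink t = 1 needs an argument: there the difference quotient is at most
  h_+^(\<beta>-1), which tends to 0 because \<beta> > 1.\<close>

lemma has_real_derivative_positive_part_powr:
  assumes "1 < \<beta>"
  shows "((\<lambda>t::real. max 0 (t - 1) powr \<beta>) has_real_derivative \<beta> * max 0 (t - 1) powr (\<beta> - 1)) (at t)"
proof -
  consider "t < 1" | "t = 1" | "t > 1" by linarith
  then show ?thesis
  proof cases
    case 1
    have "((\<lambda>t::real. 0) has_real_derivative 0) (at t)" by simp
    moreover have "eventually (\<lambda>s. s \<in> {..<1}) (nhds t)"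
      using 1 by (intro eventually_nhds_in_open) auto
    then have "eventually (\<lambda>s. 0 = max 0 (s - 1) powr \<beta>) (nhds t)"
      by (rule eventually_mono) (auto simp: max_def)
    ultimately have "((\<lambda>t::real. max 0 (t - 1) powr \<beta>) has_real_derivative 0) (at t)"
      by (rule DERIV_cong_ev[OF refl _ refl, THEN iffD1, rotated])
    then show ?thesis using 1 by (simp add: max_def)
  next
    case 3
    have "((\<lambda>t::real. (t - 1) powr \<beta>) has_real_derivative \<beta> * (t - 1) powr (\<beta> - 1)) (at t)"
      using 3 by (auto intro!: derivative_eq_intros)
    moreover have "eventually (\<lambda>s. s \<in> {1<..}) (nhds t)"
      using 3 by (intro eventually_nhds_in_open) auto
    then have "eventually (\<lambda>s. (s - 1) powr \<beta> = max 0 (s - 1) powr \<beta>) (nhds t)"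
      by (rule eventually_mono) auto
    ultimately have "((\<lambda>t::real. max 0 (t - 1) powr \<beta>) has_real_derivative \<beta> * (t - 1) powr (\<beta> - 1)) (at t)"
      by (rule DERIV_cong_ev[OF refl _ refl, THEN iffD1, rotated])
    then show ?thesis using 3 by (simp add: max_def)
  next
    case 2
    have "((\<lambda>h. (max 0 (1 + h - 1) powr \<beta> - max 0 (1 - 1) powr \<beta>) / h) \<longlongrightarrow> 0) (at (0::real))"
    proof (rule Lim_null_comparison)
      show "eventually (\<lambda>h. norm ((max 0 (1 + h - 1) powr \<beta> - max 0 (1 - 1) powr \<beta>) / h)
          \<le> max 0 h powr (\<beta> - 1)) (at (0::real))"
      proof (rule eventuallyI)
        fix h :: real
        show "norm ((max 0 (1 + h - 1) powr \<beta> - max 0 (1 - 1) powr \<beta>) / h) \<le> max 0 h powr (\<beta> - 1)"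
          by (cases "h > 0") (auto simp: max_def powr_diff)
      qed
      have "((\<lambda>h::real. max 0 h powr (\<beta> - 1)) \<longlongrightarrow> max 0 0 powr (\<beta> - 1)) (at 0)"
        using assms by (intro tendsto_intros) auto
      then show "((\<lambda>h::real. max 0 h powr (\<beta> - 1)) \<longlongrightarrow> 0) (at 0)" by simp
    qed
    then show ?thesis using 2 by (simp add: DERIV_def)
  qed
qed

lemma continuous_on_powr_nonneg:
  fixes f :: "'a::topological_space \<Rightarrow> real"
  assumes "continuous_on S f" "\<And>x. x \<in> S \<Longrightarrow> 0 \<le> f x" "0 < \<beta>"
  shows "continuous_on S (\<lambda>x. f x powr \<beta>)"
  using assms by (intro continuous_on_powr' continuous_intros) auto

lemma continuous_on_powr_pos:
  fixes f :: "'a::topological_space \<Rightarrow> real"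
  assumes "continuous_on S f" "\<And>x. x \<in> S \<Longrightarrow> 0 < f x"
  shows "continuous_on S (\<lambda>x. f x powr \<beta>)"
  using assms by (intro continuous_on_powr continuous_intros) force+

lemma powr_tangent_le:
  fixes s t p :: real
  assumes "1 \<le> p" "0 < s" "s \<le> t"
  shows "p * s powr (p - 1) * (t - s) \<le> t powr p - s powr p"
proof (cases "s = t")
  case False
  then have st: "s < t" using assms by simp
  have "\<exists>\<xi>. \<xi> > s \<and> \<xi> < t \<and> t powr p - s powr p = (t - s) * (p * \<xi> powr (p - 1))"
    by (rule MVT2[OF st]) (use assms in \<open>auto intro!: derivative_eq_intros\<close>)
  then obtain \<xi> where x: "s < \<xi>" "t powr p - s powr p = (t - s) * (p * \<xi> powr (p - 1))" by auto
  have "p * s powr (p - 1) * (t - s) \<le> p * \<xi> powr (p - 1) * (t - s)"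
    using assms x by (intro mult_right_mono mult_left_mono powr_mono2) auto
  then show ?thesis using x(2) by (simp add: mult_ac)
qed simp

text \<open>Beyond the point w0 with d w0^(\<gamma>-\<beta>) = 1 the higher power wins; below it the
  lower power is at most w0^\<beta>.\<close>

lemma powr_absorb:
  assumes "0 < \<beta>" "\<beta> < \<gamma>" "0 < d"
  shows "\<exists>E\<ge>0. \<forall>w\<ge>0::real. w powr \<beta> \<le> d * w powr \<gamma> + E"
proof -
  define w0 where "w0 = (1 / d) powr (1 / (\<gamma> - \<beta>))"
  have w0: "w0 > 0" "w0 powr (\<gamma> - \<beta>) = 1 / d" using assms by (auto simp: w0_def powr_powr)
  have "w powr \<beta> \<le> d * w powr \<gamma> + w0 powr \<beta>" if w: "w \<ge> 0" for w
  proof (cases "w \<le> w0")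
    case True
    then have "w powr \<beta> \<le> w0 powr \<beta>" using w assms by (intro powr_mono2) auto
    then show ?thesis using assms by (simp add: add_increasing)
  next
    case False
    then have "1 / d \<le> w powr (\<gamma> - \<beta>)"
      using w0 assms by (metis diff_ge_0_iff_ge less_eq_real_def not_le powr_mono2)
    then have "1 * w powr \<beta> \<le> (d * w powr (\<gamma> - \<beta>)) * w powr \<beta>"
      using assms by (intro mult_right_mono) (auto simp: field_simps)
    also have "\<dots> = d * w powr \<gamma>" by (simp add: mult.assoc flip: powr_add)
    finally show ?thesis by (simp add: add_increasing2)
  qed
  then show ?thesis by (intro exI[of _ "w0 powr \<beta>"]) auto
qed

section \<open>Semistability and the energy of truncated powers\<close>

context navier_system
begin

text \<open>Nonnegativity of the second order operator -\<Delta> - sqrt(l f'(u)) on test functions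
  compactly supported in \<Omega>, where f(t) = (t+1)^p. The square root reflects that the
  linearised problem is of fourth order.\<close>

definition semistable :: bool where
  "semistable \<longleftrightarrow> (\<forall>K \<phi> \<phi>1. c1_supp K \<phi> \<phi>1 \<longrightarrow> K \<subseteq> \<Omega> \<longrightarrow>
     (\<integral>x. sqrt (l * p * (u x + 1) powr (p - 1)) * (\<phi> x)\<^sup>2 \<partial>lborel) \<le>
     (\<integral>x. (\<Sum>b\<in>Basis. (\<phi>1 b x)\<^sup>2) \<partial>lborel))"

text \<open>By convexity the difference of two solutions of the branch is a positive supersolution of the
  linearised system, which replaces a first eigenfunction.\<close>

lemma semistableI:
  assumes "navier_system \<Omega> p m U V U1 U2 V1 V2" and lm: "l < m"
    and less: "\<And>x. x \<in> \<Omega> \<Longrightarrow> u x < U x"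
  shows semistable
  unfolding semistable_def
proof (intro allI impI)
  interpret M: navier_system \<Omega> p m U V U1 U2 V1 V2 by fact
  fix K :: "'a set" and \<phi> \<phi>1 assume \<phi>: "c1_supp K \<phi> \<phi>1" and K: "K \<subseteq> \<Omega>"
  note D = c2_on_diff[OF M.c2(1) c2(1)] and z = c2_on_diff[OF M.c2(2) c2(2)]
  have s: "0 < u x + 1" for x using u_nonneg[of x] by simp
  \<comment> \<open>The tangent inequality for the convex power at u + 1 gives the weight
    lp(u+1)^(p-1); raising l to m in front of (U+1)^p only helps.\<close>
  have lap: "(\<Sum>b\<in>Basis. V2 b x - v2 b x) \<le> - (l * p * (u x + 1) powr (p - 1) * (U x - u x))"
    if "x \<in> \<Omega>" for x
  proof -
    have "p * (u x + 1) powr (p - 1) * ((U x + 1) - (u x + 1)) \<le> (U x + 1) powr p - (u x + 1) powr p"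
      using p s less[OF that] by (intro powr_tangent_le) auto
    then have "l * (p * (u x + 1) powr (p - 1) * (U x - u x)) \<le> l * ((U x + 1) powr p - (u x + 1) powr p)"
      using l by (intro mult_left_mono) auto
    also have "\<dots> \<le> m * (U x + 1) powr p - l * (u x + 1) powr p"
      using lm by (simp add: right_diff_distrib mult_right_mono)
    finally show ?thesis using eq_v[OF that] M.eq_v[OF that] by (simp add: sum_subtractf mult_ac)
  qed
  have zpos: "0 \<le> V x - v x" if "x \<in> \<Omega>" for x
  proof (rule minimum_principle[OF open_domain bounded_domain z _ _ _ that])
    show "continuous_on (closure \<Omega>) (\<lambda>x. V x - v x)"
      using continuous M.continuous by (auto intro!: continuous_intros intro: continuous_on_subset)
    show "0 \<le> V x - v x" if "x \<in> frontier \<Omega>" for x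
      using frontier_outside[OF that] outside M.outside by simp
    show "(\<Sum>b\<in>Basis. V2 b x - v2 b x) \<le> 0" if "x \<in> \<Omega>" for x
      using lap[OF that] less[OF that] l p
      by (smt (verit) mult_nonneg_nonneg powr_ge_zero)
  qed
  show "(\<integral>x. sqrt (l * p * (u x + 1) powr (p - 1)) * (\<phi> x)\<^sup>2 \<partial>lborel) \<le>
     (\<integral>x. (\<Sum>b\<in>Basis. (\<phi>1 b x)\<^sup>2) \<partial>lborel)"
  proof (rule stability_inequality[OF \<phi> c2_on_subset[OF D K] c2_on_subset[OF z K]])
    show "continuous_on K (\<lambda>x. l * p * (u x + 1) powr (p - 1))"
      using continuous s by (intro continuous_intros continuous_on_powr_pos) (auto intro: continuous_on_subset)
    show "(\<Sum>b\<in>Basis. U2 b x - u2 b x) = - (V x - v x)" if "x \<in> K" for x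
      using eq_u M.eq_u K that by (auto simp: sum_subtractf)
  qed (use K less zpos lap l p in auto)
qed

text \<open>Powers of \<open>w\<close> are test functions whose support is compact in \<open>\<Omega>\<close>, so that no boundary terms arise.\<close>

definition w :: "'a \<Rightarrow> real" where
  "w x = max 0 (v x - 1)"

lemma w_nonneg: "0 \<le> w x" by (simp add: w_def)

lemma w_continuous: "continuous_on S w"
  unfolding w_def[abs_def] using continuous
  by (auto intro!: continuous_intros intro: continuous_on_subset)

lemma superlevel_subset: "{x. 1 \<le> v x} \<subseteq> \<Omega>"
  using outside by fastforce

lemma compact_superlevel: "compact {x. 1 \<le> v x}"
proof -
  have "closed {x. 1 \<le> v x}" using continuous by (intro closed_Collect_le continuous_intros)
  moreover have "bounded {x. 1 \<le> v x}" using superlevel_subset bounded_domain by (rule bounded_subset[rotated])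
  ultimately show ?thesis by (simp add: compact_eq_bounded_closed)
qed

lemma c1_supp_w_powr:
  assumes "1 < \<beta>"
  shows "c1_supp {x. 1 \<le> v x} (\<lambda>x. w x powr \<beta>) (\<lambda>b x. \<beta> * w x powr (\<beta> - 1) * v1 b x)"
proof -
  have "c1_on {x. 1 \<le> v x} v v1"
    using c2(2) superlevel_subset c1_on_subset by (auto simp: c2_on_def)
  then have "c1_on {x. 1 \<le> v x} (\<lambda>x. max 0 (v x - 1) powr \<beta>) (\<lambda>b x. \<beta> * max 0 (v x - 1) powr (\<beta> - 1) * v1 b x)"
    by (rule c1_on_compose)
      (use assms in \<open>auto intro!: has_real_derivative_positive_part_powr continuous_intros continuous_on_powr_nonneg\<close>)
  then show ?thesis
    using compact_superlevel by (auto simp: c1_supp_def w_def)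
qed

text \<open>The gradient of w is that of v wherever w > 0, so the squared gradient of w^\<alpha> is
  \<alpha>^2/(2\<alpha>-1) times the inner product of the gradients of w^(2\<alpha>-1) and v.
  Integration by parts then brings in -\<Delta>v.\<close>

lemma energy_identity:
  assumes "1 < \<alpha>"
  shows "(\<integral>x. (\<Sum>b\<in>Basis. (\<alpha> * w x powr (\<alpha> - 1) * v1 b x)\<^sup>2) \<partial>lborel) =
    \<alpha>\<^sup>2 / (2 * \<alpha> - 1) * (\<integral>x. l * (u x + 1) powr p * w x powr (2 * \<alpha> - 1) \<partial>lborel)"
proof -
  have b: "1 < 2 * \<alpha> - 1" using assms by simp
  note i = integral_by_parts_laplacian(3)[OF c1_supp_w_powr[OF b] c2_on_subset[OF c2(2) superlevel_subset]]
  have e: "w x powr (2 * \<alpha> - 1) * (\<Sum>b\<in>Basis. v2 b x) =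
      - (l * (u x + 1) powr p * w x powr (2 * \<alpha> - 1))" for x
  proof (cases "x \<in> \<Omega>")
    case True
    then show ?thesis using eq_v by simp
  next
    case False
    then have "w x = 0" using outside by (simp add: w_def)
    then show ?thesis by simp
  qed
  have f: "(\<Sum>b\<in>Basis. (\<alpha> * w x powr (\<alpha> - 1) * v1 b x)\<^sup>2) = \<alpha>\<^sup>2 / (2 * \<alpha> - 1) *
      (\<Sum>b\<in>Basis. (2 * \<alpha> - 1) * w x powr (2 * \<alpha> - 1 - 1) * v1 b x * v1 b x)" for x
  proof -
    have "(w x powr (\<alpha> - 1))\<^sup>2 = w x powr (2 * \<alpha> - 1 - 1)"
      by (simp add: power2_eq_square flip: powr_add)
    then show ?thesis
      using b by (simp add: sum_distrib_left power_mult_distrib) (simp add: power2_eq_square mult_ac)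
  qed
  show ?thesis unfolding f using i unfolding e by simp
qed

lemma integrable_u_w:
  assumes "0 < \<beta>"
  shows "integrable lborel (\<lambda>x. (u x + 1) powr q * w x powr \<beta>)"
proof (rule integrable_compact_support[OF compact_superlevel])
  have "0 < u x + 1" for x using u_nonneg[of x] by simp
  then show "continuous_on {x. 1 \<le> v x} (\<lambda>x. (u x + 1) powr q * w x powr \<beta>)"
    using continuous w_continuous w_nonneg assms
    by (intro continuous_intros continuous_on_powr_pos continuous_on_powr_nonneg)
      (auto intro: continuous_on_subset)
qed (simp add: w_def)

text \<open>Semistability is tested with w^\<alpha>. In the energy, the comparison estimate replaces
  (u+1)^((p+1)/2) by sqrt((p+1)/(2l)) v + 1, and v <= w + 1. The part with w reproduces the
  left-hand integral with factor \<kappa> sqrt((p+1)/2), while the rest has one power of w less; a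
  common factor sqrt l cancels.\<close>

lemma semistable_energy:
  assumes "1 < \<alpha>" semistable
  defines "\<kappa> \<equiv> \<alpha>\<^sup>2 / (2 * \<alpha> - 1)"
  shows "(sqrt p - \<kappa> * sqrt ((p + 1) / 2)) * (\<integral>x. (u x + 1) powr ((p - 1) / 2) * w x powr (2 * \<alpha>) \<partial>lborel)
    \<le> \<kappa> * (sqrt ((p + 1) / 2) + sqrt l) *
      (\<integral>x. (u x + 1) powr ((p - 1) / 2) * w x powr (2 * \<alpha> - 1) \<partial>lborel)"
proof -
  define k where "k = sqrt ((p + 1) / 2)"
  define X where "X = (\<integral>x. (u x + 1) powr ((p - 1) / 2) * w x powr (2 * \<alpha>) \<partial>lborel)"
  define Y where "Y = (\<integral>x. (u x + 1) powr ((p - 1) / 2) * w x powr (2 * \<alpha> - 1) \<partial>lborel)"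
  have \<kappa>: "\<kappa> > 0" using assms by (simp add: \<kappa>_def)
  have s: "0 < u x + 1" for x using u_nonneg[of x] by simp
  have iX: "integrable lborel (\<lambda>x. (u x + 1) powr ((p - 1) / 2) * w x powr (2 * \<alpha>))"
    and iY: "integrable lborel (\<lambda>x. (u x + 1) powr ((p - 1) / 2) * w x powr (2 * \<alpha> - 1))"
    and iZ: "integrable lborel (\<lambda>x. (u x + 1) powr p * w x powr (2 * \<alpha> - 1))"
    using assms by (auto intro!: integrable_u_w)
  have iX': "integrable lborel (\<lambda>x. k * ((u x + 1) powr ((p - 1) / 2) * w x powr (2 * \<alpha>)))"
    and iY': "integrable lborel (\<lambda>x. (k + sqrt l) * ((u x + 1) powr ((p - 1) / 2) * w x powr (2 * \<alpha> - 1)))"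
    by (intro integrable_mult_right iX iY)+
  have pw: "l * (u x + 1) powr p * w x powr (2 * \<alpha> - 1) \<le>
      sqrt l * (k * ((u x + 1) powr ((p - 1) / 2) * w x powr (2 * \<alpha>)) +
       (k + sqrt l) * ((u x + 1) powr ((p - 1) / 2) * w x powr (2 * \<alpha> - 1)))" for x
  proof -
    have "sqrt l * (u x + 1) powr ((p + 1) / 2) \<le> sqrt l * (sqrt ((p + 1) / (2 * l)) * v x + 1)"
      using comparison[of x] l by (intro mult_left_mono) auto
    also have "\<dots> = k * v x + sqrt l"
      using l by (simp add: k_def real_sqrt_divide real_sqrt_mult field_simps)
    also have "\<dots> \<le> k * w x + (k + sqrt l)"
    proof -
      have "k * v x \<le> k * (w x + 1)"
        using p by (intro mult_left_mono) (auto simp: k_def w_def)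
      then show ?thesis by (simp add: algebra_simps)
    qed
    finally have "sqrt l * ((u x + 1) powr ((p - 1) / 2) * w x powr (2 * \<alpha> - 1)) *
       (sqrt l * (u x + 1) powr ((p + 1) / 2)) \<le>
       sqrt l * ((u x + 1) powr ((p - 1) / 2) * w x powr (2 * \<alpha> - 1)) * (k * w x + (k + sqrt l))"
      using l by (intro mult_left_mono) auto
    moreover have "(u x + 1) powr ((p - 1) / 2) * (u x + 1) powr ((p + 1) / 2) = (u x + 1) powr p"
      by (simp add: field_simps flip: powr_add)
    \<comment> \<open>At zeros of w both sides are 0, since \<open>0 powr a\<close> is 0 by
      convention.\<close>
    moreover have "w x powr (2 * \<alpha> - 1) * w x = w x powr (2 * \<alpha>)"
    proof (cases "w x = 0")
      case False
      then have "w x > 0" using w_nonneg[of x] by simp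
      then show ?thesis using powr_add[of "w x" "2 * \<alpha> - 1" 1] by simp
    qed simp
    moreover have "sqrt l * sqrt l = l" using l by simp
    ultimately show ?thesis
      by (smt (verit) distrib_left mult.assoc mult.commute mult.left_commute)
  qed
  have "sqrt l * (sqrt p * X) = (\<integral>x. sqrt (l * p * (u x + 1) powr (p - 1)) * (w x powr \<alpha>)\<^sup>2 \<partial>lborel)"
  proof -
    have "sqrt (l * p * (u x + 1) powr (p - 1)) * (w x powr \<alpha>)\<^sup>2 =
      sqrt l * (sqrt p * ((u x + 1) powr ((p - 1) / 2) * w x powr (2 * \<alpha>)))" for x
    proof -
      have "sqrt ((u x + 1) powr (p - 1)) = (u x + 1) powr ((p - 1) / 2)"
        using s[of x] by (simp add: powr_half_sqrt[symmetric] powr_powr)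
      moreover have "(w x powr \<alpha>)\<^sup>2 = w x powr (2 * \<alpha>)"
        by (simp add: power2_eq_square flip: powr_add)
      ultimately show ?thesis by (simp add: real_sqrt_mult)
    qed
    then show ?thesis by (simp add: X_def)
  qed
  also have "\<dots> \<le> (\<integral>x. (\<Sum>b\<in>Basis. (\<alpha> * w x powr (\<alpha> - 1) * v1 b x)\<^sup>2) \<partial>lborel)"
    using assms(2) c1_supp_w_powr[OF assms(1)] superlevel_subset unfolding semistable_def by blast
  also have "\<dots> = \<kappa> * (\<integral>x. l * (u x + 1) powr p * w x powr (2 * \<alpha> - 1) \<partial>lborel)"
    unfolding \<kappa>_def by (rule energy_identity[OF assms(1)])
  also have "(\<integral>x. l * (u x + 1) powr p * w x powr (2 * \<alpha> - 1) \<partial>lborel) \<le>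
      (\<integral>x. sqrt l * (k * ((u x + 1) powr ((p - 1) / 2) * w x powr (2 * \<alpha>)) +
       (k + sqrt l) * ((u x + 1) powr ((p - 1) / 2) * w x powr (2 * \<alpha> - 1))) \<partial>lborel)"
    by (rule integral_mono[OF _ _ pw])
      (use iZ in \<open>simp add: mult.assoc\<close>, intro integrable_mult_right Bochner_Integration.integrable_add iX iY)
  also have "\<dots> = sqrt l * (k * X + (k + sqrt l) * Y)"
    unfolding X_def Y_def by (simp only: integral_mult_right_zero Bochner_Integration.integral_add[OF iX' iY'])
  finally have "sqrt l * (sqrt p * X) \<le> sqrt l * (\<kappa> * (k * X + (k + sqrt l) * Y))"
    using \<kappa> by (simp add: mult_ac)
  then have "sqrt p * X \<le> \<kappa> * (k * X + (k + sqrt l) * Y)" using l by simp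
  then show ?thesis by (simp add: X_def Y_def k_def algebra_simps)
qed
end

section \<open>Uniform integral bounds for semistable solutions\<close>

context navier_system
begin

text \<open>Integrals are taken over the closure because it is compact: continuous integrands are
  integrable there, including powers of u + 1, which do not vanish outside the domain.\<close>

lemma integrable_closure:
  assumes "continuous_on UNIV f"
  shows "set_integrable lborel (closure \<Omega>) (f :: 'a \<Rightarrow> real)"
  unfolding set_integrable_def
  using assms bounded_domain by (intro borel_integrable_compact) (auto intro: continuous_on_subset)

lemma integral_closure_w:
  assumes "\<And>x. w x = 0 \<Longrightarrow> f x = 0"
  shows "(LBINT x:closure \<Omega>. f x) = (\<integral>x. (f x :: real) \<partial>lborel)"
  unfolding set_lebesgue_integral_def
proof (rule Bochner_Integration.integral_cong)
  fix x
  have "x \<notin> closure \<Omega> \<Longrightarrow> x \<notin> \<Omega>" using closure_subset by blast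
  then have "x \<notin> closure \<Omega> \<Longrightarrow> w x = 0" by (simp add: w_def outside)
  then show "indicator (closure \<Omega>) x *\<^sub>R f x = f x"
    using assms by (auto simp: indicator_def)
qed simp

end

text \<open>Absorbing w^(2\<alpha>-1) into w^(2\<alpha>) leaves a constant times the weight a, which
  is not bounded. But a grows at most linearly in w and 2\<alpha> > 1, so this remainder is absorbed
  in turn.\<close>

lemma absorb_weighted:
  fixes \<alpha> A B c :: real
  assumes "1 < \<alpha>" "0 < A" "0 < B" "1 \<le> c"
  shows "\<exists>E\<ge>0. \<forall>w\<ge>0. \<forall>a\<ge>1. a \<le> c * (w + 1) \<longrightarrow>
    B * (a * w powr (2 * \<alpha> - 1)) \<le> A / 2 * (a * w powr (2 * \<alpha>)) + E"
proof -
  obtain E1 where E1: "E1 \<ge> 0" "\<And>w. w \<ge> 0 \<Longrightarrow> w powr (2 * \<alpha> - 1) \<le> A / (4 * B) * w powr (2 * \<alpha>) + E1"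
    using powr_absorb[of "2 * \<alpha> - 1" "2 * \<alpha>" "A / (4 * B)"] assms by auto
  \<comment> \<open>Each of the two absorptions may use a quarter of A; the + 1 keeps the
    denominator positive when E1 = 0.\<close>
  define d where "d = A / (4 * (B * E1 * c + 1))"
  have pos: "B * E1 * c + 1 > 0" using assms E1 by (simp add: add_nonneg_pos)
  then have d: "d > 0" using assms by (simp add: d_def)
  obtain E2 where E2: "E2 \<ge> 0" "\<And>w. w \<ge> 0 \<Longrightarrow> w powr 1 \<le> d * w powr (2 * \<alpha>) + E2"
    using powr_absorb[of 1 "2 * \<alpha>" d] assms d by auto
  have "B * (a * w powr (2 * \<alpha> - 1)) \<le> A / 2 * (a * w powr (2 * \<alpha>)) + B * E1 * c * (E2 + 1)"
    if w: "w \<ge> 0" and a: "a \<ge> 1" "a \<le> c * (w + 1)" for w a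
  proof -
    have "B * (a * w powr (2 * \<alpha> - 1)) \<le> B * (a * (A / (4 * B) * w powr (2 * \<alpha>) + E1))"
      using E1(2)[OF w] a assms by (intro mult_left_mono) auto
    also have "\<dots> = A / 4 * (a * w powr (2 * \<alpha>)) + B * E1 * a"
      using assms by (simp add: field_simps)
    also have "B * E1 * a \<le> B * E1 * (c * (d * w powr (2 * \<alpha>) + E2 + 1))"
    proof (rule mult_left_mono)
      have "c * (w + 1) \<le> c * (d * w powr (2 * \<alpha>) + E2 + 1)"
        using E2(2)[OF w] w assms by (intro mult_left_mono) auto
      then show "a \<le> c * (d * w powr (2 * \<alpha>) + E2 + 1)" using a by simp
    qed (use assms E1 in auto)
    also have "\<dots> = (B * E1 * c) * d * w powr (2 * \<alpha>) + B * E1 * c * (E2 + 1)"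
      by (simp add: algebra_simps)
    also have "(B * E1 * c) * d * w powr (2 * \<alpha>) \<le> A / 4 * (a * w powr (2 * \<alpha>))"
    proof -
      have "(B * E1 * c) * d \<le> A / 4" using assms E1 pos by (simp add: d_def field_simps)
      then have "(B * E1 * c) * d * w powr (2 * \<alpha>) \<le> A / 4 * w powr (2 * \<alpha>)"
        by (rule mult_right_mono) simp
      also have "\<dots> \<le> A / 4 * (a * w powr (2 * \<alpha>))"
      proof (rule mult_left_mono)
        have "1 * w powr (2 * \<alpha>) \<le> a * w powr (2 * \<alpha>)" using a by (intro mult_right_mono) auto
        then show "w powr (2 * \<alpha>) \<le> a * w powr (2 * \<alpha>)" by simp
      qed (use assms in simp)
      finally show ?thesis .
    qed
    finally show ?thesis by (simp add: algebra_simps)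
  qed
  moreover have "B * E1 * c * (E2 + 1) \<ge> 0" using assms E1 E2 by simp
  ultimately show ?thesis by blast
qed

text \<open>Absorption bounds the integral of (u+1)^((p-1)/2) w^(2\<alpha>), and the comparison
  estimate turns w^(2\<alpha>) back into (u+1)^((p+1)\<alpha>) up to lower order. The bound l0
  controls the constant of the comparison and l1 the factor sqrt l, so that one C serves all
  systems.\<close>

lemma integral_bound_of_semistable:
  fixes \<Omega> :: "'a::euclidean_space set"
  assumes "1 < p" "0 < l0" "1 < \<alpha>" and \<kappa>: "\<alpha>\<^sup>2 / (2 * \<alpha> - 1) < sqrt (2 * p / (p + 1))"
  shows "\<exists>C. \<forall>l u v u1 u2 v1 v2. navier_system \<Omega> p l u v u1 u2 v1 v2 \<longrightarrow>
    navier_system.semistable \<Omega> p l u \<longrightarrow> l0 \<le> l \<longrightarrow> l \<le> l1 \<longrightarrow>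
    (LBINT x:closure \<Omega>. (u x + 1) powr ((p - 1) / 2 + (p + 1) * \<alpha>)) \<le> C"
proof -
  define \<kappa>' where "\<kappa>' = \<alpha>\<^sup>2 / (2 * \<alpha> - 1)"
  define A where "A = sqrt p - \<kappa>' * sqrt ((p + 1) / 2)"
  define B where "B = \<kappa>' * (sqrt ((p + 1) / 2) + sqrt \<bar>l1\<bar>)"
  \<comment> \<open>The + 1 accounts for the additive 1 of the comparison estimate, after v and 1
    are both bounded by w + 1.\<close>
  define c where "c = sqrt ((p + 1) / (2 * l0)) + 1"
  have k0: "\<kappa>' > 0" using assms by (simp add: \<kappa>'_def)
  \<comment> \<open>The assumption on \<alpha> says exactly that the coefficient on the left of
    \<open>semistable_energy\<close> is positive.\<close>
  have A: "A > 0"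
  proof -
    have "\<kappa>' * sqrt ((p + 1) / 2) < sqrt (2 * p / (p + 1)) * sqrt ((p + 1) / 2)"
      using \<kappa> assms by (intro mult_strict_right_mono) (auto simp: \<kappa>'_def)
    also have "\<dots> = sqrt p" using assms by (simp flip: real_sqrt_mult)
    finally show ?thesis by (simp add: A_def)
  qed
  have B: "B > 0" using k0 assms by (simp add: B_def add_pos_nonneg)
  have c: "c \<ge> 1" using assms by (simp add: c_def)
  obtain E where E: "E \<ge> 0" "\<And>w a. w \<ge> 0 \<Longrightarrow> a \<ge> 1 \<Longrightarrow> a \<le> c * (w + 1) \<Longrightarrow>
    B * (a * w powr (2 * \<alpha> - 1)) \<le> A / 2 * (a * w powr (2 * \<alpha>)) + E"
    using absorb_weighted[OF assms(3) A B c] by blast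
  define m where "m = measure lborel (closure \<Omega>)"
  define D where "D = c powr (2 * \<alpha>) * 2 powr (2 * \<alpha>) * (1 + 2 * c)"
  have D: "D \<ge> 0" using c by (simp add: D_def)
  have "(LBINT x:closure \<Omega>. (u x + 1) powr ((p - 1) / 2 + (p + 1) * \<alpha>)) \<le> D * (2 * E * m / A + m)"
    if ns: "navier_system \<Omega> p l u v u1 u2 v1 v2" and ss: "navier_system.semistable \<Omega> p l u"
      and lb: "l0 \<le> l" "l \<le> l1" for l u v u1 u2 v1 v2
  proof -
    interpret navier_system \<Omega> p l u v u1 u2 v1 v2 by fact
    define a where "a x = (u x + 1) powr ((p - 1) / 2)" for x
    have s: "1 \<le> u x + 1" for x using u_nonneg[of x] by simp
    have a1: "1 \<le> a x" for x using s[of x] assms by (simp add: a_def ge_one_powr_ge_zero)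
    have sc: "(u x + 1) powr ((p + 1) / 2) \<le> c * (w x + 1)" for x
    proof -
      have "(u x + 1) powr ((p + 1) / 2) \<le> sqrt ((p + 1) / (2 * l)) * v x + 1" by (rule comparison)
      also have "\<dots> \<le> sqrt ((p + 1) / (2 * l0)) * (w x + 1) + (w x + 1)"
      proof (intro add_mono mult_mono)
        show "sqrt ((p + 1) / (2 * l)) \<le> sqrt ((p + 1) / (2 * l0))"
          using lb assms by (intro real_sqrt_le_mono frac_le) auto
      qed (use v_nonneg assms in \<open>auto simp: w_def\<close>)
      finally show ?thesis by (simp add: c_def algebra_simps)
    qed
    have ac: "a x \<le> c * (w x + 1)" for x
    proof -
      have "a x \<le> (u x + 1) powr ((p + 1) / 2)" unfolding a_def using s[of x] by (intro powr_mono) auto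
      then show ?thesis using sc[of x] by simp
    qed
    let ?X = "\<lambda>x. a x * w x powr (2 * \<alpha>)" and ?Y = "\<lambda>x. a x * w x powr (2 * \<alpha> - 1)"
    have ca: "continuous_on UNIV a"
      unfolding a_def[abs_def] using continuous u_nonneg
      by (intro continuous_on_powr_pos continuous_intros) (auto simp: add_nonneg_pos)
    have iX: "set_integrable lborel (closure \<Omega>) ?X" and iY: "set_integrable lborel (closure \<Omega>) ?Y"
      using assms ca w_continuous w_nonneg
      by (auto intro!: integrable_closure continuous_intros continuous_on_powr_nonneg)
    have i1: "set_integrable lborel (closure \<Omega>) (\<lambda>x. k)" for k :: real
      by (rule integrable_closure) simp
    have m: "(LBINT x:closure \<Omega>. k) = k * m" for k :: real
      using bounded_domain by (simp add: m_def set_lebesgue_integral_def)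
    define X where "X = (LBINT x:closure \<Omega>. ?X x)"
    have "A * X \<le> \<kappa>' * (sqrt ((p + 1) / 2) + sqrt l) * (LBINT x:closure \<Omega>. ?Y x)"
      using semistable_energy[OF assms(3) ss]
      by (simp add: X_def integral_closure_w A_def \<kappa>'_def a_def)
    also have "\<dots> \<le> B * (LBINT x:closure \<Omega>. ?Y x)"
    proof (rule mult_right_mono)
      show "\<kappa>' * (sqrt ((p + 1) / 2) + sqrt l) \<le> B"
        unfolding B_def using k0 lb by (intro mult_left_mono add_left_mono) auto
      show "0 \<le> (LBINT x:closure \<Omega>. ?Y x)"
        unfolding set_lebesgue_integral_def
        using order.trans[OF zero_le_one a1] by (intro Bochner_Integration.integral_nonneg) simp
    qed
    also have "\<dots> = (LBINT x:closure \<Omega>. B * ?Y x)" by simp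
    also have "\<dots> \<le> (LBINT x:closure \<Omega>. A / 2 * ?X x + E)"
      using E(2)[OF w_nonneg a1 ac] iX iY i1
      by (intro set_integral_mono set_integral_add set_integrable_mult_right) auto
    also have "\<dots> = A / 2 * X + E * m"
    proof -
      have "set_integrable lborel (closure \<Omega>) (\<lambda>x. A / 2 * ?X x)"
        using iX by (intro set_integrable_mult_right)
      from set_integral_add(2)[OF this i1[of E]] show ?thesis by (simp only: set_integral_mult_right m X_def)
    qed
    finally have X: "X \<le> 2 * E * m / A" using A by (simp add: field_simps)
    have pw: "(u x + 1) powr ((p - 1) / 2 + (p + 1) * \<alpha>) \<le> D * (?X x + 1)" for x
    proof -
      have w0: "0 \<le> w x" by (rule w_nonneg)
      have "(u x + 1) powr ((p + 1) * \<alpha>) = ((u x + 1) powr ((p + 1) / 2)) powr (2 * \<alpha>)"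
        by (simp add: powr_powr)
      also have "\<dots> \<le> (c * (w x + 1)) powr (2 * \<alpha>)"
        using sc[of x] assms by (intro powr_mono2) auto
      also have "\<dots> = c powr (2 * \<alpha>) * (w x + 1) powr (2 * \<alpha>)"
        using c w0 by (simp add: powr_mult)
      also have "(w x + 1) powr (2 * \<alpha>) \<le> 2 powr (2 * \<alpha>) * (w x powr (2 * \<alpha>) + 1)"
      proof (cases "w x \<le> 1")
        case True
        then have "(w x + 1) powr (2 * \<alpha>) \<le> 2 powr (2 * \<alpha>) * 1"
          using w0 assms by (simp add: powr_mono2)
        also have "\<dots> \<le> 2 powr (2 * \<alpha>) * (w x powr (2 * \<alpha>) + 1)" by (intro mult_left_mono) auto
        finally show ?thesis .
      next
        case False
        then have "(w x + 1) powr (2 * \<alpha>) \<le> (2 * w x) powr (2 * \<alpha>)"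
          using w0 assms by (intro powr_mono2) auto
        also have "\<dots> = 2 powr (2 * \<alpha>) * w x powr (2 * \<alpha>)" using w0 by (simp add: powr_mult)
        also have "\<dots> \<le> 2 powr (2 * \<alpha>) * (w x powr (2 * \<alpha>) + 1)" by (intro mult_left_mono) auto
        finally show ?thesis .
      qed
      finally have 1: "(u x + 1) powr ((p + 1) * \<alpha>) \<le>
          c powr (2 * \<alpha>) * (2 powr (2 * \<alpha>) * (w x powr (2 * \<alpha>) + 1))"
        by (simp add: mult_left_mono)
      \<comment> \<open>Expanding the power of w + 1 leaves the bare weight a. It is controlled too:
        a <= c(w+1), and w <= a w^(2\<alpha>) + 1 because a >= 1.\<close>
      have "w x \<le> ?X x + 1"
      proof (cases "w x \<le> 1")
        case True
        then show ?thesis using a1[of x] by (simp add: add_increasing)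
      next
        case False
        then have "w x \<le> 1 * w x powr (2 * \<alpha>)"
          using assms powr_mono[of 1 "2 * \<alpha>" "w x"] by simp
        also have "\<dots> \<le> ?X x" using a1[of x] by (intro mult_right_mono) auto
        finally show ?thesis by simp
      qed
      moreover have X0: "?X x \<ge> 0" using a1[of x] by simp
      ultimately have "c * (w x + 1) \<le> c * (2 * (?X x + 1))" using c by (intro mult_left_mono) auto
      then have 2: "a x \<le> 2 * c * (?X x + 1)" using ac[of x] by (simp add: algebra_simps)
      have "(u x + 1) powr ((p - 1) / 2 + (p + 1) * \<alpha>) = a x * (u x + 1) powr ((p + 1) * \<alpha>)"
        by (simp add: a_def powr_add)
      also have "\<dots> \<le> a x * (c powr (2 * \<alpha>) * (2 powr (2 * \<alpha>) * (w x powr (2 * \<alpha>) + 1)))"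
        using 1 a1[of x] by (intro mult_left_mono) auto
      also have "\<dots> = c powr (2 * \<alpha>) * 2 powr (2 * \<alpha>) * (?X x + a x)" by (simp add: algebra_simps)
      also have "\<dots> \<le> c powr (2 * \<alpha>) * 2 powr (2 * \<alpha>) * ((1 + 2 * c) * (?X x + 1))"
        using 2 by (intro mult_left_mono) (auto simp: algebra_simps)
      finally show ?thesis by (simp add: D_def mult_ac)
    qed
    have "(LBINT x:closure \<Omega>. (u x + 1) powr ((p - 1) / 2 + (p + 1) * \<alpha>)) \<le>
        (LBINT x:closure \<Omega>. D * (?X x + 1))"
    proof (rule set_integral_mono[OF _ _ pw])
      show "set_integrable lborel (closure \<Omega>) (\<lambda>x. (u x + 1) powr ((p - 1) / 2 + (p + 1) * \<alpha>))"
        using continuous u_nonneg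
        by (intro integrable_closure continuous_on_powr_pos continuous_intros) (auto simp: add_nonneg_pos)
      show "set_integrable lborel (closure \<Omega>) (\<lambda>x. D * (?X x + 1))"
        using iX i1 by (intro set_integrable_mult_right set_integral_add)
    qed
    also have "\<dots> = D * (X + m)"
      using set_integral_add(2)[OF iX i1[of 1]] m[of 1] by (simp add: X_def)
    also have "\<dots> \<le> D * (2 * E * m / A + m)" using X D by (intro mult_left_mono) auto
    finally show ?thesis .
  qed
  then show ?thesis by blast
qed

section \<open>The uniform bound\<close>

lemma set_integral_indicator_cball:
  "(LBINT y:cball x r. (k::real)) = k * unit_ball_vol (real DIM('a)) * r ^ DIM('a)"
  if "0 \<le> r" for x :: "'a::euclidean_space"
  using that by (simp add: set_lebesgue_integral_def content_cball)

lemma sum_inner_Basis_square: "(\<Sum>b\<in>Basis. (y \<bullet> b)\<^sup>2) = y \<bullet> (y::'a::euclidean_space)"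
  using euclidean_inner[of y y] by (simp add: power2_eq_square)

text \<open>The field $y \mapsto \rho(|y-x|^2) (|y-x|^2+e)^{-\mu} (y-x)$ with a cutoff \<open>\<rho>\<close> has total divergence \<open>0\<close>,
  and its divergence dominates a multiple of the kernel since $2\mu$ is below the dimension. The cutoff
  is flat to order $n \ge \mu$ at the centre, which keeps its derivative from meeting the singularity.\<close>

lemma regularised_riesz_kernel_integral_bound:
  assumes \<mu>: "0 < \<mu>" "2 * \<mu> < real DIM('a::euclidean_space)" and R: "0 < R"
  shows "\<exists>C. \<forall>(x::'a) e. 0 < e \<longrightarrow> e \<le> 1 \<longrightarrow>
    (LBINT y:cball x R. ((y - x) \<bullet> (y - x) + e) powr - \<mu>) \<le> C"
proof -
  define n where "n = DIM('a)"
  \<comment> \<open>The cutoff vanishes for |y-x|^2 >= Q, and Q > R^2 keeps it away from 0 on the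
    ball of radius R.\<close>
  define Q where "Q = R\<^sup>2 + 1"
  have Q: "Q > 0" by (simp add: Q_def add_nonneg_pos)
  have n: "n > 0" by (simp add: n_def)
  define c where "c = (Q ^ n - (R\<^sup>2) ^ n)\<^sup>2 * (real n - 2 * \<mu>)"
  have QR: "Q ^ n > (R\<^sup>2) ^ n" using n by (intro power_strict_mono) (auto simp: Q_def)
  then have c: "c > 0" using \<mu> by (simp add: c_def n_def)
  \<comment> \<open>Bounds the term 4n (Q^n - t^n) t^n (t+e)^(-\<mu>) produced by the derivative of
    the cutoff, for 0 <= t <= Q and e <= 1.\<close>
  define k where "k = 4 * real n * Q ^ n * (Q + 1) ^ n"
  have "(LBINT y:cball x R. ((y - x) \<bullet> (y - x) + e) powr - \<mu>) \<le>
      k * unit_ball_vol n * sqrt Q ^ n / c" if e: "0 < e" "e \<le> 1" for x :: 'a and e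
  proof -
    define T where "T y = (y - x) \<bullet> (y - x)" for y
    have T0: "0 \<le> T y" for y by (simp add: T_def)
    have TK: "y \<in> cball x (sqrt r) \<longleftrightarrow> T y \<le> r" if "0 \<le> r" for y r
    proof -
      have "dist x y = sqrt (T y)" by (metis T_def dist_commute dist_norm norm_eq_sqrt_inner)
      then show ?thesis using that by simp
    qed
    \<comment> \<open>This is (Q^n - t^n)_+^2; the summands 1 and -1 match the form of
      \<open>has_real_derivative_positive_part_powr\<close>.\<close>
    define \<rho> where "\<rho> t = max 0 (1 + Q ^ n - t ^ n - 1) powr 2" for t
    define \<rho>1 where "\<rho>1 t = (2 * max 0 (1 + Q ^ n - t ^ n - 1) powr (2 - 1)) * (- (real n * t ^ (n - 1)))" for t
    define g where "g t = \<rho> t * (t + e) powr - \<mu>" for t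
    define g1 where "g1 t = \<rho>1 t * (t + e) powr - \<mu> + \<rho> t * (- \<mu> * (t + e) powr (- \<mu> - 1))" for t
    have "((\<lambda>t. 1 + Q ^ n - t ^ n) has_real_derivative - (real n * t ^ (n - 1))) (at t)" for t
      by (auto intro!: derivative_eq_intros)
    from DERIV_chain2[OF has_real_derivative_positive_part_powr this, of 2]
    have \<rho>d: "(\<rho> has_real_derivative \<rho>1 t) (at t)" for t
      by (simp add: \<rho>_def[abs_def] \<rho>1_def)
    have gd: "(g has_real_derivative g1 t) (at t)" if "t \<ge> 0" for t
      unfolding g_def[abs_def] g1_def using that e
      by (auto intro!: derivative_eq_intros \<rho>d simp: algebra_simps)
    have cont: "continuous_on S (\<lambda>y. g (T y))" "continuous_on S (\<lambda>y. g1 (T y))" for S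
    proof -
      have cT: "continuous_on S T" unfolding T_def[abs_def] by (intro continuous_intros)
      have "continuous_on S (\<lambda>y. (T y + e) powr q)" for q
        using cT T0 e by (intro continuous_on_powr_pos continuous_intros) (auto simp: add_nonneg_pos)
      moreover have "continuous_on S (\<lambda>y. \<rho> (T y))" "continuous_on S (\<lambda>y. \<rho>1 (T y))"
        unfolding \<rho>_def \<rho>1_def using cT by (auto intro!: continuous_intros continuous_on_powr_nonneg)
      ultimately show "continuous_on S (\<lambda>y. g (T y))" "continuous_on S (\<lambda>y. g1 (T y))"
        unfolding g_def g1_def by (auto intro!: continuous_on_mult continuous_on_diff continuous_on_const)
    qed
    define K where "K = cball x (sqrt Q)"
    have K: "compact K" by (simp add: K_def)
    have out: "\<rho> (T y) = 0" "\<rho>1 (T y) = 0" if "y \<notin> K" for y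
    proof -
      have "T y > Q" using that TK[of Q y] Q by (simp add: K_def)
      then have "T y ^ n \<ge> Q ^ n" using Q by (intro power_mono) auto
      then show "\<rho> (T y) = 0" "\<rho>1 (T y) = 0" by (auto simp: \<rho>_def \<rho>1_def)
    qed
    then have out': "g (T y) = 0" "g1 (T y) = 0" if "y \<notin> K" for y
      using that by (simp_all add: g_def g1_def)
    define D where "D b y = g1 (T y) * (2 * ((y - x) \<bullet> b)) * ((y - x) \<bullet> b) + g (T y) * (b \<bullet> b)" for b y
    have iD: "integrable lborel (D b)" for b
      unfolding D_def[abs_def]
      by (rule integrable_compact_support[OF K]) (use out' cont in \<open>auto intro!: continuous_intros\<close>)
    have D0: "integral\<^sup>L lborel (D b) = 0" for b
    proof (rule integral_dir_deriv_eq_0[OF K, of "\<lambda>y. g (T y) * ((y - x) \<bullet> b)" _ b])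
      show "has_dir_deriv (\<lambda>y. g (T y) * ((y - x) \<bullet> b)) (D b y) b y" for y
        unfolding D_def T_def
        by (intro has_dir_deriv_mult has_dir_deriv_inner has_dir_deriv_compose gd
            has_dir_deriv_norm_square inner_ge_zero)
    qed (use out' cont in \<open>auto simp: D_def intro!: continuous_intros\<close>)
    have "(\<integral>y. (\<Sum>b\<in>Basis. D b y) \<partial>lborel) = 0"
      using D0 iD by (simp add: Bochner_Integration.integral_sum)
    have pw: "c * (indicator (cball x R) y * (T y + e) powr - \<mu>) \<le>
        (\<Sum>b\<in>Basis. D b y) + indicator K y * k" for y
    proof -
      have "(\<Sum>b\<in>Basis. D b y) = 2 * T y * g1 (T y) + real n * g (T y)"
      proof -
        have "(\<Sum>b\<in>Basis. D b y) = (\<Sum>b\<in>Basis. 2 * g1 (T y) * ((y - x) \<bullet> b)\<^sup>2 + g (T y))"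
          by (intro sum.cong) (auto simp: D_def power2_eq_square)
        also have "\<dots> = 2 * g1 (T y) * T y + real n * g (T y)"
          using sum_inner_Basis_square[of "y - x"]
          by (simp add: sum.distrib n_def T_def flip: sum_distrib_left)
        finally show ?thesis by (simp add: mult_ac)
      qed
      also have "\<dots> = \<rho> (T y) * (real n * (T y + e) powr - \<mu> - 2 * \<mu> * (T y * (T y + e) powr (- \<mu> - 1)))
          + 2 * T y * \<rho>1 (T y) * (T y + e) powr - \<mu>"
        by (simp add: g_def g1_def algebra_simps)
      finally have S: "(\<Sum>b\<in>Basis. D b y) = \<dots>" .
      have te: "T y + e > 0" using T0[of y] e by simp
      have \<rho>0: "\<rho> (T y) \<ge> 0" by (simp add: \<rho>_def)
      \<comment> \<open>This term enters with the factor -2\<mu>, so enlarging T to T + e bounds the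
        divergence from below and leaves n - 2\<mu> > 0.\<close>
      have "T y * (T y + e) powr (- \<mu> - 1) \<le> (T y + e) * (T y + e) powr (- \<mu> - 1)"
        using e by (intro mult_right_mono) auto
      also have "\<dots> = (T y + e) powr - \<mu>" using te by (simp add: powr_mult_base)
      finally have "(real n - 2 * \<mu>) * (T y + e) powr - \<mu> \<le>
          real n * (T y + e) powr - \<mu> - 2 * \<mu> * (T y * (T y + e) powr (- \<mu> - 1))"
        using \<mu> by (simp add: algebra_simps)
      from mult_left_mono[OF this \<rho>0]
      have 1: "\<rho> (T y) * ((real n - 2 * \<mu>) * (T y + e) powr - \<mu>) \<le>
          \<rho> (T y) * (real n * (T y + e) powr - \<mu> - 2 * \<mu> * (T y * (T y + e) powr (- \<mu> - 1)))" .
      have 2: "c * (indicator (cball x R) y * (T y + e) powr - \<mu>) \<le>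
          \<rho> (T y) * ((real n - 2 * \<mu>) * (T y + e) powr - \<mu>)"
      proof (cases "y \<in> cball x R")
        case True
        then have "T y \<le> R\<^sup>2" using TK[of "R\<^sup>2" y] R by simp
        then have "T y ^ n \<le> (R\<^sup>2) ^ n" using T0 by (intro power_mono) auto
        then have "(Q ^ n - (R\<^sup>2) ^ n)\<^sup>2 \<le> (Q ^ n - T y ^ n)\<^sup>2"
          using QR by (intro power_mono) auto
        also have "\<dots> = \<rho> (T y)" using \<open>T y ^ n \<le> (R\<^sup>2) ^ n\<close> QR by (simp add: \<rho>_def max_def)
        finally have "(Q ^ n - (R\<^sup>2) ^ n)\<^sup>2 * ((real n - 2 * \<mu>) * (T y + e) powr - \<mu>) \<le>
            \<rho> (T y) * ((real n - 2 * \<mu>) * (T y + e) powr - \<mu>)"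
          using \<mu> by (intro mult_right_mono) (auto simp: n_def)
        then show ?thesis using True by (simp add: c_def mult_ac)
      next
        case False
        then show ?thesis using \<rho>0 \<mu> by (simp add: n_def)
      qed
      have 3: "- (2 * T y * \<rho>1 (T y) * (T y + e) powr - \<mu>) \<le> indicator K y * k"
      proof (cases "y \<in> K")
        case True
        then have tQ: "T y \<le> Q" using TK[of Q y] Q by (simp add: K_def)
        have "- (2 * T y * \<rho>1 (T y) * (T y + e) powr - \<mu>) =
          4 * real n * max 0 (Q ^ n - T y ^ n) * (T y ^ n * (T y + e) powr - \<mu>)"
          using n by (cases n) (auto simp: \<rho>1_def mult_ac)
        also have "\<dots> \<le> 4 * real n * Q ^ n * (Q + 1) ^ n"
        proof (intro mult_mono)
          have "T y ^ n * (T y + e) powr - \<mu> \<le> (T y + e) ^ n * (T y + e) powr - \<mu>"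
            using T0 e by (intro mult_right_mono power_mono) auto
          also have "\<dots> = (T y + e) powr (real n - \<mu>)"
            using te by (simp add: powr_realpow powr_diff powr_minus divide_inverse)
          also have "\<dots> \<le> (Q + 1) powr (real n - \<mu>)"
            using te tQ e \<mu> by (intro powr_mono2) (auto simp: n_def)
          also have "\<dots> \<le> (Q + 1) powr real n" using Q \<mu> by (intro powr_mono) auto
          also have "\<dots> = (Q + 1) ^ n" using Q by (simp add: powr_realpow)
          finally show "T y ^ n * (T y + e) powr - \<mu> \<le> (Q + 1) ^ n" .
        qed (use Q T0 in auto)
        finally show ?thesis using True by (simp add: k_def)
      qed (use out in simp)
      show ?thesis using S 1 2 3 by linarith
    qed
    have ik: "integrable lborel (\<lambda>y. indicator K y * k)"
      using borel_integrable_compact[OF K, of "\<lambda>_. k"] by simp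
    have ic: "integrable lborel (\<lambda>y. indicator (cball x R) y * (T y + e) powr - \<mu>)"
    proof -
      have "integrable lborel (\<lambda>y. indicator (cball x R) y *\<^sub>R (T y + e) powr - \<mu>)"
        using e unfolding T_def
        by (intro borel_integrable_compact continuous_on_powr_pos continuous_intros) (auto simp: add_nonneg_pos)
      then show ?thesis by simp
    qed
    have "c * (LBINT y:cball x R. (T y + e) powr - \<mu>) =
        (\<integral>y. c * (indicator (cball x R) y * (T y + e) powr - \<mu>) \<partial>lborel)"
      by (simp add: set_lebesgue_integral_def)
    also have "\<dots> \<le> (\<integral>y. (\<Sum>b\<in>Basis. D b y) + indicator K y * k \<partial>lborel)"
      by (rule integral_mono[OF _ _ pw]) (use ic ik iD in auto)
    also have "\<dots> = (LBINT y:K. k)"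
      using \<open>(\<integral>y. (\<Sum>b\<in>Basis. D b y) \<partial>lborel) = 0\<close> iD ik
      by (simp add: set_lebesgue_integral_def)
    also have "\<dots> = k * unit_ball_vol n * sqrt Q ^ n"
      using Q by (simp add: K_def set_integral_indicator_cball n_def)
    finally show ?thesis using c by (simp add: T_def field_simps)
  qed
  then show ?thesis by blast
qed

text \<open>With $t = |y-x|^2 + e$ the function \<open>H t\<close> is a multiple of the regularised fundamental solution of
  the Laplacian.\<close>

lemma fundamental_profile:
  assumes "2 \<le> n" and m: "real n / 2 - 1 < m" and R: "0 < R"
  shows "\<exists>H C. 0 \<le> C \<and> (\<forall>t>0. (H has_real_derivative - (t powr - (real n / 2))) (at t)) \<and>
    (\<forall>t>0. t \<le> R \<longrightarrow> 0 \<le> H t \<and> H t \<le> C * t powr - m)"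
\<comment> \<open>For n = 2 the profile is logarithmic, normalised to vanish at R; otherwise it is a
  power of order n/2 - 1. An m above that order dominates both by t^(-m).\<close>
proof (cases "n = 2")
  case True
  have m0: "m > 0" using m True by simp
  have "((\<lambda>t. ln R - ln t) has_real_derivative - (t powr - (real n / 2))) (at t)" if "t > 0" for t
    using that True by (auto intro!: derivative_eq_intros simp: powr_minus field_simps)
  moreover have "0 \<le> ln R - ln t \<and> ln R - ln t \<le> R powr m / m * t powr - m" if "t > 0" "t \<le> R" for t
  proof -
    have "ln (R / t) \<le> (R / t) powr m / m"
      using that m0 by (intro ln_powr_bound) auto
    moreover have "ln (R / t) = ln R - ln t" using that R by (simp add: ln_div)
    moreover have "(R / t) powr m / m = R powr m / m * t powr - m"
      using that R by (simp add: powr_divide powr_minus_divide)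
    moreover have "0 \<le> ln (R / t)" using that by simp
    ultimately show ?thesis by simp
  qed
  ultimately show ?thesis
    using m0 by (intro exI[of _ "\<lambda>t. ln R - ln t"] exI[of _ "R powr m / m"]) auto
next
  case False
  define q where "q = real n / 2 - 1"
  have q: "q > 0" using False assms(1) by (simp add: q_def)
  have "((\<lambda>t. t powr - q / q) has_real_derivative - (t powr - (real n / 2))) (at t)" if "t > 0" for t
  proof -
    have "((\<lambda>t. t powr - q / q) has_real_derivative (- q * t powr (- q - 1)) / q) (at t)"
      using that by (auto intro!: derivative_eq_intros)
    moreover have "- q - 1 = - (real n / 2)" by (simp add: q_def)
    ultimately show ?thesis using q by simp
  qed
  moreover have "t powr - q / q \<le> R powr (m - q) / q * t powr - m" if "t > 0" "t \<le> R" for t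
  proof -
    have "t powr - q = t powr (m - q) * t powr - m" by (simp flip: powr_add)
    also have "\<dots> \<le> R powr (m - q) * t powr - m"
      using that m by (intro mult_right_mono powr_mono2) (auto simp: q_def)
    finally show ?thesis using q by (simp add: divide_right_mono)
  qed
  ultimately show ?thesis
    using q by (intro exI[of _ "\<lambda>t. t powr - q / q"] exI[of _ "R powr (m - q) / q"]) auto
qed

lemma Young_product_bound:
  fixes a b q :: real
  assumes "0 \<le> a" "0 \<le> b" "1 < q"
  shows "a * b \<le> a powr q + b powr (q / (q - 1))"
proof (cases "b \<le> a powr (q - 1)")
  case True
  then have "a * b \<le> a * a powr (q - 1)" using assms by (intro mult_left_mono) auto
  also have "\<dots> = a powr q" using assms by (cases "a = 0") (auto simp: powr_mult_base)
  finally show ?thesis by (simp add: add_increasing2)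
next
  case False
  then have "(a powr (q - 1)) powr (1 / (q - 1)) \<le> b powr (1 / (q - 1))"
    using assms by (intro powr_mono2) auto
  then have "a \<le> b powr (1 / (q - 1))" using assms by (simp add: powr_powr)
  then have "a * b \<le> b powr (1 / (q - 1)) * b" using assms by (intro mult_right_mono) auto
  also have "\<dots> = b powr (1 + 1 / (q - 1))" using assms by (cases "b = 0") (auto simp: powr_add)
  also have "1 + 1 / (q - 1) = q / (q - 1)" using assms by (simp add: field_simps)
  finally show ?thesis by (simp add: add_increasing)
qed

section \<open>Bounding the maximum of v\<close>

context navier_system
begin

text \<open>\<Phi> = H(|y-x0|^2 + e) is nonnegative on \<Omega> and -\<Delta>\<Phi> = 2ne(|y-x0|^2 +
  e)^(-n/2-1) concentrates at x0 for small e. It serves as a Green function without boundary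
  condition, the cutoff w^3 making up for that. After one integration by parts, the gradient of w^3
  equals 3w^2 times that of v. Passing to the gradient of w^2 \<Phi> discards 6w\<Phi> times the
  squared gradient of v, which has the right sign; a second integration by parts leaves 3w^2 \<Phi>
  l(u+1)^p. Since w <= max v, a factor (max v)^2 cancels.\<close>

lemma sup_estimate:
  fixes x0 :: 'a
  defines "T \<equiv> \<lambda>y. (y - x0) \<bullet> (y - x0)" and "n \<equiv> DIM('a)"
  assumes H: "\<And>t. 0 < t \<Longrightarrow> (H has_real_derivative - (t powr - (real n / 2))) (at t)"
    and Hb: "\<And>t. 0 < t \<Longrightarrow> t \<le> R \<Longrightarrow> 0 \<le> H t \<and> H t \<le> C * t powr - m"
    and C: "0 \<le> C" and R: "\<And>y. y \<in> \<Omega> \<Longrightarrow> T y + 1 \<le> R"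
    and max: "\<And>y. v y \<le> v x0" and large: "2 \<le> v x0"
  shows "\<exists>e>0. e \<le> 1 \<and> v x0 * (real n * unit_ball_vol n * 2 powr - (real n / 2) / 64) \<le>
    3 * C * l * (LBINT y:closure \<Omega>. (T y + e) powr - m * (u y + 1) powr p)"
proof -
  define M where "M = v x0"
  have M: "M \<ge> 2" using large by (simp add: M_def)
  have n: "real n > 0" by (simp add: n_def)
  have "isCont v x0" using continuous by (simp add: continuous_on_eq_continuous_at)
  then obtain r where r: "r > 0" "\<And>y. dist y x0 < r \<Longrightarrow> dist (v y) (v x0) < M / 4"
    using M unfolding continuous_at_eps_delta by (metis divide_pos_pos less_le_trans zero_less_numeral)
  \<comment> \<open>On the ball of radius sqrt e, v differs from its maximum by less than M/4. So e
    depends on the solution; the final bound uses only 0 < e <= 1.\<close>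
  define e where "e = min 1 ((r / 2)\<^sup>2)"
  have e: "0 < e" "e \<le> 1" "e \<le> (r / 2)\<^sup>2" using r by (auto simp: e_def)
  have "sqrt e \<le> sqrt ((r / 2)\<^sup>2)" using e by (intro real_sqrt_le_mono)
  then have se: "sqrt e < r" using r by simp
  have T0: "0 \<le> T y" for y by (simp add: T_def)
  have te: "0 < T y + e" for y using T0[of y] e by simp
  have cT: "continuous_on S T" for S unfolding T_def by (intro continuous_intros)
  have cTe: "continuous_on S (\<lambda>y. (T y + e) powr q)" for S q
    using te cT by (intro continuous_on_powr_pos continuous_intros)
  define \<Phi> where "\<Phi> y = H (T y + e)" for y
  define \<psi>1 where "\<psi>1 t = - ((t + e) powr - (real n / 2))" for t
  define \<psi>2 where "\<psi>2 t = real n / 2 * (t + e) powr (- (real n / 2) - 1)" for t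
  define \<Phi>1 where "\<Phi>1 b y = \<psi>1 (T y) * (2 * ((y - x0) \<bullet> b))" for b y
  define \<Phi>2 where "\<Phi>2 b y = \<psi>2 (T y) * (2 * ((y - x0) \<bullet> b))\<^sup>2 + \<psi>1 (T y) * 2" for b y
  have \<Phi>: "c2_on UNIV \<Phi> \<Phi>1 \<Phi>2"
    unfolding \<Phi>_def[abs_def] \<Phi>1_def[abs_def] \<Phi>2_def[abs_def]
  proof (rule c2_on_compose[where ?h = T and ?\<psi> = "\<lambda>t. H (t + e)"])
    show "c2_on UNIV T (\<lambda>b y. 2 * ((y - x0) \<bullet> b)) (\<lambda>b y. 2)"
      unfolding T_def by (rule c2_on_norm_square)
    fix t assume "t \<in> range T"
    then have t: "t + e > 0" using te by auto
    have "((\<lambda>t. t + e) has_real_derivative 1) (at t)" by (auto intro!: derivative_eq_intros)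
    from DERIV_chain2[OF H[OF t] this]
    show "((\<lambda>t. H (t + e)) has_real_derivative \<psi>1 t) (at t)" by (simp add: \<psi>1_def)
    show "(\<psi>1 has_real_derivative \<psi>2 t) (at t)"
      unfolding \<psi>1_def[abs_def] \<psi>2_def using t by (auto intro!: derivative_eq_intros)
  next
    show "continuous_on (range T) \<psi>2"
      unfolding \<psi>2_def[abs_def] using te by (intro continuous_intros continuous_on_powr_pos) auto
  qed
  have lap: "(\<Sum>b\<in>Basis. \<Phi>2 b y) = - (2 * real n * e * (T y + e) powr (- (real n / 2) - 1))" for y
  proof -
    have "(\<Sum>b\<in>Basis. \<Phi>2 b y) = 4 * \<psi>2 (T y) * (\<Sum>b\<in>Basis. ((y - x0) \<bullet> b)\<^sup>2) + 2 * real n * \<psi>1 (T y)"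
      by (simp add: \<Phi>2_def sum.distrib sum_distrib_left n_def power_mult_distrib mult_ac)
    also have "(\<Sum>b\<in>Basis. ((y - x0) \<bullet> b)\<^sup>2) = T y" by (simp add: sum_inner_Basis_square T_def)
    also have "\<psi>1 (T y) = - ((T y + e) * (T y + e) powr (- (real n / 2) - 1))"
      using te[of y] by (simp add: \<psi>1_def powr_mult_base)
    finally show ?thesis by (simp add: \<psi>2_def algebra_simps)
  qed
  let ?K = "{x. 1 \<le> v x}"
  note K = superlevel_subset
  have \<Phi>K: "c2_on ?K \<Phi> \<Phi>1 \<Phi>2" and vK: "c2_on ?K v v1 v2"
    using c2_on_subset[OF \<Phi>] c2_on_subset[OF c2(2) K] by auto
  have \<Phi>c: "c1_on ?K \<Phi> \<Phi>1" using \<Phi>K by (simp add: c2_on_def)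
  have s3: "c1_supp ?K (\<lambda>x. w x powr 3) (\<lambda>b x. 3 * w x powr (3 - 1) * v1 b x)"
    by (rule c1_supp_w_powr) simp
  have s2: "c1_supp ?K (\<lambda>x. w x powr 2) (\<lambda>b x. 2 * w x powr (2 - 1) * v1 b x)"
    by (rule c1_supp_w_powr) simp
  note i3 = integral_by_parts_laplacian[OF s3 \<Phi>K]
  note i2 = integral_by_parts_laplacian[OF c1_supp_mult[OF s2 \<Phi>c] vK]
  have \<Phi>pos: "0 \<le> \<Phi> y" "\<Phi> y \<le> C * (T y + e) powr - m" if "y \<in> \<Omega>" for y
    using Hb[OF te[of y]] R[OF that] e by (auto simp: \<Phi>_def)
  have "- (\<integral>x. w x powr 3 * (\<Sum>b\<in>Basis. \<Phi>2 b x) \<partial>lborel) =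
      (\<integral>x. (\<Sum>b\<in>Basis. 3 * w x powr (3 - 1) * v1 b x * \<Phi>1 b x) \<partial>lborel)"
    using i3(3) by simp
  also have "\<dots> \<le> (\<integral>x. 3 * (\<Sum>b\<in>Basis. (2 * w x powr (2 - 1) * v1 b x * \<Phi> x + w x powr 2 * \<Phi>1 b x) * v1 b x) \<partial>lborel)"
  proof (rule integral_mono[OF i3(2)])
    show "integrable lborel (\<lambda>x. 3 * (\<Sum>b\<in>Basis. (2 * w x powr (2 - 1) * v1 b x * \<Phi> x + w x powr 2 * \<Phi>1 b x) * v1 b x))"
      using i2(2) by (rule integrable_mult_right)
    fix x
    show "(\<Sum>b\<in>Basis. 3 * w x powr (3 - 1) * v1 b x * \<Phi>1 b x) \<le>
      3 * (\<Sum>b\<in>Basis. (2 * w x powr (2 - 1) * v1 b x * \<Phi> x + w x powr 2 * \<Phi>1 b x) * v1 b x)"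
      unfolding sum_distrib_left
    proof (rule sum_mono)
      fix b
      have "0 \<le> 6 * w x powr (2 - 1) * \<Phi> x * (v1 b x * v1 b x)"
      proof (cases "x \<in> \<Omega>")
        case True
        then show ?thesis using \<Phi>pos by (intro mult_nonneg_nonneg[OF _ zero_le_square]) auto
      next
        case False
        then have "w x = 0" using outside by (simp add: w_def)
        then show ?thesis by simp
      qed
      then show "3 * w x powr (3 - 1) * v1 b x * \<Phi>1 b x \<le>
          3 * ((2 * w x powr (2 - 1) * v1 b x * \<Phi> x + w x powr 2 * \<Phi>1 b x) * v1 b x)"
        by (simp add: algebra_simps)
    qed
  qed
  also have "\<dots> = 3 * - (\<integral>x. w x powr 2 * \<Phi> x * (\<Sum>b\<in>Basis. v2 b x) \<partial>lborel)"
    using i2(3) by simp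
  also have "\<dots> = 3 * (\<integral>x. - (w x powr 2 * \<Phi> x * (\<Sum>b\<in>Basis. v2 b x)) \<partial>lborel)" by simp
  also have "\<dots> \<le> 3 * (LBINT y:closure \<Omega>. C * l * M\<^sup>2 * ((T y + e) powr - m * (u y + 1) powr p))"
    unfolding set_lebesgue_integral_def
  proof (intro mult_left_mono integral_mono)
    show "integrable lborel (\<lambda>x. - (w x powr 2 * \<Phi> x * (\<Sum>b\<in>Basis. v2 b x)))"
      using i2(1) by simp
    have "set_integrable lborel (closure \<Omega>) (\<lambda>y. C * l * M\<^sup>2 * ((T y + e) powr - m * (u y + 1) powr p))"
      using cTe continuous u_nonneg
      by (intro integrable_closure continuous_on_mult continuous_on_const continuous_on_powr_pos[of _ "\<lambda>x. u x + 1"])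
        (auto intro!: continuous_intros simp: add_nonneg_pos)
    then show "integrable lborel (\<lambda>y. indicator (closure \<Omega>) y *\<^sub>R (C * l * M\<^sup>2 * ((T y + e) powr - m * (u y + 1) powr p)))"
      by (simp add: set_integrable_def)
    fix y
    show "- (w y powr 2 * \<Phi> y * (\<Sum>b\<in>Basis. v2 b y)) \<le>
      indicator (closure \<Omega>) y *\<^sub>R (C * l * M\<^sup>2 * ((T y + e) powr - m * (u y + 1) powr p))"
    proof (cases "y \<in> \<Omega>")
      case True
      then have cl: "y \<in> closure \<Omega>" using closure_subset by blast
      have "w y \<le> M" using max[of y] M by (simp add: w_def M_def)
      then have "w y powr 2 \<le> M powr 2" using w_nonneg by (intro powr_mono2) auto
      then have w2: "w y powr 2 \<le> M\<^sup>2" using M w_nonneg[of y] by (simp add: powr_numeral)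
      have "- (w y powr 2 * \<Phi> y * (\<Sum>b\<in>Basis. v2 b y)) = w y powr 2 * \<Phi> y * (l * (u y + 1) powr p)"
        using eq_v[OF True] by simp
      also have "\<dots> \<le> M\<^sup>2 * (C * (T y + e) powr - m) * (l * (u y + 1) powr p)"
        using w2 \<Phi>pos[OF True] l by (intro mult_mono) auto
      finally show ?thesis using cl by (simp add: mult_ac)
    next
      case False
      then have "w y = 0" using outside by (simp add: w_def)
      then show ?thesis using C l by (auto simp: indicator_def)
    qed
  qed simp
  also have "\<dots> = M\<^sup>2 * (3 * C * l * (LBINT y:closure \<Omega>. (T y + e) powr - m * (u y + 1) powr p))"
    by (simp add: mult_ac)
  finally have upper: "- (\<integral>x. w x powr 3 * (\<Sum>b\<in>Basis. \<Phi>2 b x) \<partial>lborel) \<le> \<dots>" .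
  have lower: "(M / 4) ^ 3 * (2 * real n * e * (2 * e) powr (- (real n / 2) - 1)) * (unit_ball_vol n * sqrt e ^ n)
      \<le> - (\<integral>x. w x powr 3 * (\<Sum>b\<in>Basis. \<Phi>2 b x) \<partial>lborel)"
  proof -
    let ?k = "(M / 4) ^ 3 * (2 * real n * e * (2 * e) powr (- (real n / 2) - 1))"
    have "?k * (unit_ball_vol n * sqrt e ^ n) = (\<integral>y. indicator (cball x0 (sqrt e)) y * ?k \<partial>lborel)"
      using set_integral_indicator_cball[of "sqrt e" x0 ?k] e
      unfolding set_lebesgue_integral_def n_def real_scaleR_def by (simp only: mult.assoc real_sqrt_ge_0_iff less_imp_le)
    also have "\<dots> \<le> (\<integral>x. - (w x powr 3 * (\<Sum>b\<in>Basis. \<Phi>2 b x)) \<partial>lborel)"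
    proof (rule integral_mono)
      show "integrable lborel (\<lambda>y. indicator (cball x0 (sqrt e)) y * ?k)"
        using borel_integrable_compact[of "cball x0 (sqrt e)" "\<lambda>_. ?k"] by simp
      show "integrable lborel (\<lambda>x. - (w x powr 3 * (\<Sum>b\<in>Basis. \<Phi>2 b x)))"
        using i3(1) by simp
      fix y
      show "indicator (cball x0 (sqrt e)) y * ?k \<le> - (w y powr 3 * (\<Sum>b\<in>Basis. \<Phi>2 b y))"
      proof (cases "y \<in> cball x0 (sqrt e)")
        case True
        then have d: "dist y x0 \<le> sqrt e" by (simp add: dist_commute)
        have "T y = (dist y x0)\<^sup>2" by (simp add: T_def dist_norm power2_norm_eq_inner)
        also have "\<dots> \<le> (sqrt e)\<^sup>2" using d by (intro power_mono) auto
        finally have Te: "T y \<le> e" using e by simp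
        have "\<bar>v y - M\<bar> < M / 4" using r(2)[of y] d se by (simp add: M_def dist_real_def)
        \<comment> \<open>Here v > 3M/4, and M >= 2 gives 1 <= M/2.\<close>
        then have "M / 4 \<le> w y" using M unfolding w_def by linarith
        then have "(M / 4) ^ 3 \<le> w y ^ 3" using M by (intro power_mono) auto
        also have "w y ^ 3 = w y powr 3" using w_nonneg[of y] by (simp add: powr_numeral)
        finally have "(M / 4) ^ 3 * (2 * real n * e * (2 * e) powr (- (real n / 2) - 1)) \<le>
            w y powr 3 * (2 * real n * e * (T y + e) powr (- (real n / 2) - 1))"
          using e n te[of y] Te by (intro mult_mono powr_mono2') auto
        then show ?thesis using True by (simp add: lap)
      next
        case False
        have "0 \<le> w y powr 3 * (2 * real n * e * (T y + e) powr (- (real n / 2) - 1))"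
          using e by (intro mult_nonneg_nonneg) auto
        then show ?thesis using False by (simp add: lap)
      qed
    qed
    finally show ?thesis by simp
  qed
  \<comment> \<open>The powers of e cancel, because 2e (2e)^(-n/2-1) e^(n/2) = 2^(-n/2); the 64 is
    4^3.\<close>
  have eq: "(M / 4) ^ 3 * (2 * real n * e * (2 * e) powr (- (real n / 2) - 1)) * (unit_ball_vol n * sqrt e ^ n)
     = M\<^sup>2 * (M * (real n * unit_ball_vol n * 2 powr - (real n / 2) / 64))"
  proof -
    have "(2 * e) powr (- (real n / 2) - 1) = 2 powr (- (real n / 2)) / 2 * (e powr - (real n / 2) / e)"
      using e by (simp add: powr_mult powr_diff)
    moreover have "sqrt e ^ n = e powr (real n / 2)"
      using e by (simp add: powr_half_sqrt[symmetric] powr_powr flip: powr_realpow)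
    moreover have "e powr - (real n / 2) * e powr (real n / 2) = 1"
      using e by (simp flip: powr_add)
    ultimately show ?thesis using e by (simp add: power2_eq_square power3_eq_cube)
  qed
  have "M\<^sup>2 * (M * (real n * unit_ball_vol n * 2 powr - (real n / 2) / 64)) \<le>
     M\<^sup>2 * (3 * C * l * (LBINT y:closure \<Omega>. (T y + e) powr - m * (u y + 1) powr p))"
    using order.trans[OF lower upper] unfolding eq .
  then have "M * (real n * unit_ball_vol n * 2 powr - (real n / 2) / 64) \<le>
     3 * C * l * (LBINT y:closure \<Omega>. (T y + e) powr - m * (u y + 1) powr p)"
    by (rule mult_left_le_imp_le) (use M in simp)
  then show ?thesis using e by (auto simp: M_def)
qed

end

text \<open>All exponents and constants are fixed before the solution is chosen, so B is uniform in
  l. The comparison estimate is used twice: to bound the surplus powers of u + 1 by powers of max v,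
  and at the end to pass from v to u.\<close>

lemma sup_bound_of_integral_bound:
  fixes \<Omega> :: "'a::euclidean_space set"
  assumes "2 \<le> DIM('a)" and bdd: "bounded \<Omega>" and p: "1 < p" and l0: "0 < l0"
    and q0: "(p - 1) * real DIM('a) / 4 < q0"
  shows "\<exists>B. \<forall>l u v u1 u2 v1 v2. navier_system \<Omega> p l u v u1 u2 v1 v2 \<longrightarrow> l0 \<le> l \<longrightarrow> l \<le> l1 \<longrightarrow>
    (LBINT x:closure \<Omega>. (u x + 1) powr q0) \<le> C0 \<longrightarrow> (\<forall>x. u x \<le> B)"
proof -
  define n where "n = DIM('a)"
  have n: "2 \<le> n" using assms(1) by (simp add: n_def)
  \<comment> \<open>The lower bound makes the dual power of the fundamental solution integrable; the
    upper one gives q0/q > (p-1)/2, which yields \<theta> < 1.\<close>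
  obtain q where q: "real n / 2 < q" "q < 2 * q0 / (p - 1)"
  proof -
    have "real n / 2 < 2 * q0 / (p - 1)" using q0 p by (simp add: n_def field_simps)
    then show ?thesis using dense that by blast
  qed
  have q1: "1 < q" using q(1) n by simp
  have q2: "(p - 1) / 2 < q0 / q" using q(2) q1 p by (simp add: field_simps)
  define q' where "q' = q / (q - 1)"
  \<comment> \<open>Above n/2 - 1, t^(-m) dominates the fundamental solution; below n/(2q'), the
    power q' of |y-x|^(-2m) is still locally integrable. The interval is nonempty because q >
    n/2.\<close>
  obtain m where m: "real n / 2 - 1 < m" "m < real n / 2 / q'"
  proof -
    have "real n / 2 / q' = real n / 2 - real n / 2 / q" using q1 by (simp add: q'_def field_simps)
    moreover have "real n / 2 / q < 1" using q q1 by (simp add: field_simps)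
    ultimately have "real n / 2 - 1 < real n / 2 / q'" by linarith
    then show ?thesis using dense that by blast
  qed
  have m0: "0 < m" using m(1) n by simp
  have q'0: "0 < q'" using q1 by (simp add: q'_def)
  have \<mu>: "0 < m * q'" "2 * (m * q') < real DIM('a)"
    using m0 q'0 m(2) by (auto simp: n_def field_simps)
  obtain R0 where R0: "0 < R0" "\<And>y. y \<in> closure \<Omega> \<Longrightarrow> norm y \<le> R0"
    using bounded_closure[OF bdd] by (auto simp: bounded_pos)
  define R where "R = (2 * R0)\<^sup>2 + 1"
  have R: "0 < R" by (simp add: R_def add_nonneg_pos)
  obtain H C where C: "0 \<le> C"
    and H: "\<And>t. 0 < t \<Longrightarrow> (H has_real_derivative - (t powr - (real DIM('a) / 2))) (at t)"
    and Hb: "\<And>t. 0 < t \<Longrightarrow> t \<le> R \<Longrightarrow> 0 \<le> H t \<and> H t \<le> C * t powr - m"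
    using fundamental_profile[OF n m(1) R] unfolding n_def by blast
  obtain Ck where Ck: "\<And>(x::'a) e. 0 < e \<Longrightarrow> e \<le> 1 \<Longrightarrow>
      (LBINT y:cball x (2 * R0). ((y - x) \<bullet> (y - x) + e) powr - (m * q')) \<le> Ck"
    using regularised_riesz_kernel_integral_bound[OF \<mu>, of "2 * R0"] R0 by auto
  \<comment> \<open>The power of sup (u+1) that is taken out of the integral. The first entry
    ensures that it is positive; both are below (p+1)/2.\<close>
  define r where "r = max ((p + 1) / 4) (p - q0 / q)"
  define \<theta> where "\<theta> = r * (2 / (p + 1))"
  have "p - q0 / q < (p + 1) / 2" using q2 by argo
  moreover have "(p + 1) / 4 < (p + 1) / 2" "0 < (p + 1) / 4" using p by auto
  ultimately have r: "0 < r" "r < (p + 1) / 2"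
    unfolding r_def by (simp_all only: less_max_iff_disj max_less_iff_conj simp_thms)
  have \<theta>: "0 < \<theta>" "\<theta> < 1" using r p by (auto simp: \<theta>_def field_simps)
  define c where "c = sqrt ((p + 1) / (2 * l0)) + 1"
  have c: "1 \<le> c" using p l0 by (simp add: c_def)
  define k where "k = real n * unit_ball_vol n * 2 powr - (real n / 2) / 64"
  have k: "0 < k" using n by (simp add: k_def)
  define D where "D = 3 * C * \<bar>l1\<bar> * c powr \<theta> * (\<bar>C0\<bar> + \<bar>Ck\<bar>) / k"
  have D: "0 \<le> D" using C k by (simp add: D_def)
  obtain E where E: "0 \<le> E" "\<And>y. 0 \<le> y \<Longrightarrow> y powr \<theta> \<le> 1 / (2 * (D + 1)) * y powr 1 + E"
    using powr_absorb[of \<theta> 1 "1 / (2 * (D + 1))"] \<theta> D by auto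
  \<comment> \<open>Solves v <= (v+1)/2 + DE at the maximum; the 2 also covers a maximum below 2,
    where \<open>sup_estimate\<close> does not apply.\<close>
  define M where "M = 2 + 2 * D * E"
  have "u x \<le> (c * (M + 1)) powr (2 / (p + 1))"
    if ns: "navier_system \<Omega> p l u v u1 u2 v1 v2" and lb: "l0 \<le> l" "l \<le> l1"
      and C0: "(LBINT x:closure \<Omega>. (u x + 1) powr q0) \<le> C0" for l u v u1 u2 v1 v2 x
  proof -
    interpret navier_system \<Omega> p l u v u1 u2 v1 v2 by fact
    have s1: "1 \<le> u y + 1" for y using u_nonneg[of y] by simp
    have sv: "u y + 1 \<le> (c * (A + 1)) powr (2 / (p + 1))" if "v y \<le> A" for y A
    proof -
      have "(u y + 1) powr ((p + 1) / 2) \<le> sqrt ((p + 1) / (2 * l)) * v y + 1" by (rule comparison)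
      also have "\<dots> \<le> sqrt ((p + 1) / (2 * l0)) * (A + 1) + (A + 1)"
        using v_nonneg[of y] that lb l0 p
        by (intro add_mono mult_mono real_sqrt_le_mono frac_le) auto
      also have "\<dots> = c * (A + 1)" by (simp add: c_def algebra_simps)
      finally have "((u y + 1) powr ((p + 1) / 2)) powr (2 / (p + 1)) \<le> (c * (A + 1)) powr (2 / (p + 1))"
        using p by (intro powr_mono2) auto
      moreover have "(p + 1) / 2 * (2 / (p + 1)) = 1" using p by simp
      ultimately show ?thesis using u_nonneg[of y] by (simp only: powr_powr) simp
    qed
    have "\<exists>x0. \<forall>y. v y \<le> v x0"
    proof (cases "\<Omega> = {}")
      case True
      then show ?thesis using outside by simp
    next
      case False
      have "compact (closure \<Omega>)" "closure \<Omega> \<noteq> {}" using False bounded_domain by auto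
      moreover have "continuous_on (closure \<Omega>) v"
        using continuous(2) by (rule continuous_on_subset) simp
      ultimately obtain x0 where x0: "\<And>y. y \<in> closure \<Omega> \<Longrightarrow> v y \<le> v x0"
        using continuous_attains_sup by metis
      then have "v y \<le> v x0" for y
        using outside(2)[of y] v_nonneg[of x0] closure_subset[of \<Omega>] by (cases "y \<in> \<Omega>") auto
      then show ?thesis by blast
    qed
    then obtain x0 where x0: "\<And>y. v y \<le> v x0" by blast
    have "v x0 \<le> M"
    proof (cases "2 \<le> v x0")
      case False
      then show ?thesis using D E(1) by (simp add: M_def add_increasing2)
    next
      case True
      then have x0\<Omega>: "x0 \<in> \<Omega>" using outside(2)[of x0] by (cases "x0 \<in> \<Omega>") auto
      have near: "y \<in> cball x0 (2 * R0)" if "y \<in> closure \<Omega>" for y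
      proof -
        have "dist x0 y \<le> norm x0 + norm y" by (simp add: dist_norm norm_triangle_ineq4)
        then show ?thesis using R0(2)[OF that] R0(2)[of x0] x0\<Omega> closure_subset[of \<Omega>] by auto
      qed
      have "(y - x0) \<bullet> (y - x0) + 1 \<le> R" if "y \<in> \<Omega>" for y
      proof -
        have "dist y x0 \<le> 2 * R0" using near[of y] that closure_subset by (auto simp: dist_commute)
        then have "(dist y x0)\<^sup>2 \<le> (2 * R0)\<^sup>2" by (intro power_mono) auto
        then show ?thesis by (simp add: R_def dist_norm power2_norm_eq_inner)
      qed
      from sup_estimate[OF H Hb C this x0 True] obtain e where e: "0 < e" "e \<le> 1"
        and est: "v x0 * k \<le> 3 * C * l *
          (LBINT y:closure \<Omega>. ((y - x0) \<bullet> (y - x0) + e) powr - m * (u y + 1) powr p)"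
        unfolding k_def n_def by blast
      define T where "T y = (y - x0) \<bullet> (y - x0) + e" for y
      have T: "0 < T y" for y using e by (simp add: T_def add_nonneg_pos)
      define S where "S = (c * (v x0 + 1)) powr (2 / (p + 1))"
      have S: "u y + 1 \<le> S" for y unfolding S_def by (rule sv[OF x0])
      have S1: "1 \<le> S" using S[of x0] s1[of x0] by linarith
      have pw: "T y powr - m * (u y + 1) powr p \<le> S powr r * ((u y + 1) powr q0 + T y powr - (m * q'))" for y
      proof -
        have "(u y + 1) powr p = (u y + 1) powr (p - q0 / q) * (u y + 1) powr (q0 / q)"
          by (simp flip: powr_add)
        also have "\<dots> \<le> (u y + 1) powr r * (u y + 1) powr (q0 / q)"
          using s1[of y] by (intro mult_right_mono powr_mono) (auto simp: r_def)
        also have "\<dots> \<le> S powr r * (u y + 1) powr (q0 / q)"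
          using s1[of y] S r by (intro mult_right_mono powr_mono2) auto
        finally have "T y powr - m * (u y + 1) powr p \<le> T y powr - m * (S powr r * (u y + 1) powr (q0 / q))"
          by (intro mult_left_mono) auto
        also have "\<dots> = S powr r * ((u y + 1) powr (q0 / q) * T y powr - m)" by simp
        also have "\<dots> \<le> S powr r * (((u y + 1) powr (q0 / q)) powr q + (T y powr - m) powr q')"
          unfolding q'_def using q1 by (intro mult_left_mono Young_product_bound) auto
        also have "\<dots> = S powr r * ((u y + 1) powr q0 + T y powr - (m * q'))"
          using q1 by (simp add: powr_powr)
        finally show ?thesis .
      qed
      have cT: "continuous_on X (\<lambda>y. T y powr a)" for a X
        using T unfolding T_def[abs_def] by (intro continuous_on_powr_pos continuous_intros) auto
      have cu: "continuous_on UNIV (\<lambda>y. (u y + 1) powr a)" for a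
        using s1 continuous by (intro continuous_on_powr_pos continuous_intros) (auto simp: u_nonneg add_nonneg_pos)
      have ik: "set_integrable lborel (closure \<Omega>) (\<lambda>y. T y powr - (m * q'))"
        by (intro integrable_closure cT)
      have iq: "set_integrable lborel (closure \<Omega>) (\<lambda>y. (u y + 1) powr q0)"
        by (intro integrable_closure cu)
      have K: "(LBINT y:closure \<Omega>. T y powr - (m * q')) \<le> Ck"
      proof -
        have "(LBINT y:closure \<Omega>. T y powr - (m * q')) \<le> (LBINT y:cball x0 (2 * R0). T y powr - (m * q'))"
          unfolding set_lebesgue_integral_def
        proof (rule integral_mono)
          show "integrable lborel (\<lambda>y. indicator (cball x0 (2 * R0)) y *\<^sub>R T y powr - (m * q'))"
            by (intro borel_integrable_compact cT) simp
        qed (use ik near in \<open>auto simp: set_integrable_def indicator_def\<close>)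
        also have "\<dots> \<le> Ck" unfolding T_def by (rule Ck[OF e])
        finally show ?thesis .
      qed
      have "(LBINT y:closure \<Omega>. T y powr - m * (u y + 1) powr p) \<le>
          (LBINT y:closure \<Omega>. S powr r * ((u y + 1) powr q0 + T y powr - (m * q')))"
      proof (rule set_integral_mono[OF _ _ pw])
        show "set_integrable lborel (closure \<Omega>) (\<lambda>y. T y powr - m * (u y + 1) powr p)"
          by (intro integrable_closure continuous_on_mult cT cu)
        show "set_integrable lborel (closure \<Omega>) (\<lambda>y. S powr r * ((u y + 1) powr q0 + T y powr - (m * q')))"
          by (intro integrable_closure continuous_on_mult continuous_on_add continuous_on_const cT cu)
      qed
      also have "\<dots> = S powr r * ((LBINT y:closure \<Omega>. (u y + 1) powr q0) + (LBINT y:closure \<Omega>. T y powr - (m * q')))"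
        by (simp only: set_integral_mult_right set_integral_add(2)[OF iq ik])
      also have "\<dots> \<le> S powr r * (\<bar>C0\<bar> + \<bar>Ck\<bar>)"
        using C0 K by (intro mult_left_mono) auto
      finally have I: "(LBINT y:closure \<Omega>. T y powr - m * (u y + 1) powr p) \<le> S powr r * (\<bar>C0\<bar> + \<bar>Ck\<bar>)" .
      have "v x0 * k \<le> 3 * C * l * (LBINT y:closure \<Omega>. T y powr - m * (u y + 1) powr p)"
        using est unfolding T_def .
      also have "\<dots> \<le> 3 * C * l * (S powr r * (\<bar>C0\<bar> + \<bar>Ck\<bar>))"
        using I C l by (intro mult_left_mono) auto
      also have "\<dots> \<le> 3 * C * \<bar>l1\<bar> * (S powr r * (\<bar>C0\<bar> + \<bar>Ck\<bar>))"
        using C lb by (intro mult_right_mono mult_left_mono) auto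
      also have "S powr r = c powr \<theta> * (v x0 + 1) powr \<theta>"
        using c True by (simp add: S_def powr_powr \<theta>_def mult.commute powr_mult)
      finally have "v x0 \<le> D * (v x0 + 1) powr \<theta>"
        using k by (simp add: D_def field_simps)
      also have "\<dots> \<le> D * (1 / (2 * (D + 1)) * (v x0 + 1) + E)"
        using E(2)[of "v x0 + 1"] True D by (intro mult_left_mono) auto
      also have "\<dots> = D / (D + 1) * ((v x0 + 1) / 2) + D * E"
        using D by (simp add: field_simps)
      also have "D / (D + 1) * ((v x0 + 1) / 2) \<le> 1 * ((v x0 + 1) / 2)"
        using D True by (intro mult_right_mono) auto
      finally have "v x0 \<le> (v x0 + 1) / 2 + D * E" by simp
      then have "v x0 \<le> 2 + 2 * (D * E)" by (simp add: field_simps)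
      then show ?thesis by (simp add: M_def mult.assoc)
    qed
    then have "v x \<le> M" using x0[of x] by simp
    from sv[OF this] show ?thesis by simp
  qed
  then show ?thesis by blast
qed

text \<open>With t = sqrt(2p/(p+1)), the condition \<alpha>^2/(2\<alpha>-1) < t reads (\<alpha>-t)^2
  < t^2 - t for \<alpha> > 1/2, with upper end a = t + sqrt(t^2-t). Multiplied by p - 1, the
  hypothesis on N is the last inequality at \<alpha> = a, because p - (p+1)/2 = (p-1)/2. Being
  strict, it persists for some \<alpha> between t > 1 and a.\<close>

lemma semistable_exponent:
  fixes p N :: real
  assumes p: "1 < p"
    and N: "N / 4 < p / (p - 1) + (p + 1) / (p - 1) *
      (sqrt (2 * p / (p + 1)) + sqrt (2 * p / (p + 1) - sqrt (2 * p / (p + 1))) - 1 / 2)"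
  obtains \<alpha> where "1 < \<alpha>" "\<alpha>\<^sup>2 / (2 * \<alpha> - 1) < sqrt (2 * p / (p + 1))"
    "(p - 1) * N / 4 < (p - 1) / 2 + (p + 1) * \<alpha>"
proof -
  define t where "t = sqrt (2 * p / (p + 1))"
  have t2: "t\<^sup>2 = 2 * p / (p + 1)" using p by (simp add: t_def)
  have t1: "1 < t" using p by (simp add: t_def)
  then have tt: "0 < t\<^sup>2 - t" by (simp add: power2_eq_square)
  define a where "a = t + sqrt (t\<^sup>2 - t)"
  have "(p - 1) * (N / 4) < (p - 1) * (p / (p - 1) + (p + 1) / (p - 1) * (a - 1 / 2))"
    using N p by (intro mult_strict_left_mono) (auto simp: a_def t_def)
  also have "\<dots> = p + (p + 1) * (a - 1 / 2)" using p by (simp add: distrib_left)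
  also have "\<dots> = (p - 1) / 2 + (p + 1) * a" by (simp add: field_simps)
  finally have "((p - 1) * N / 4 - (p - 1) / 2) / (p + 1) < a" using p by (simp add: field_simps)
  moreover have "t < a" using tt by (simp add: a_def)
  ultimately obtain \<alpha> where \<alpha>: "max t (((p - 1) * N / 4 - (p - 1) / 2) / (p + 1)) < \<alpha>" "\<alpha> < a"
    using dense[of "max t (((p - 1) * N / 4 - (p - 1) / 2) / (p + 1))" a] by auto
  have "(\<alpha> - t)\<^sup>2 < (sqrt (t\<^sup>2 - t))\<^sup>2" using \<alpha> by (intro power_strict_mono) (auto simp: a_def)
  then have "\<alpha>\<^sup>2 < t * (2 * \<alpha> - 1)" using tt by (simp add: power2_eq_square algebra_simps)
  moreover have "1 < \<alpha>" using \<alpha> t1 by simp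
  ultimately have "\<alpha>\<^sup>2 / (2 * \<alpha> - 1) < t" by (simp add: pos_divide_less_eq)
  moreover have "(p - 1) * N / 4 < (p - 1) / 2 + (p + 1) * \<alpha>"
    using \<alpha>(1) p by (simp add: field_simps)
  ultimately show ?thesis using that \<open>1 < \<alpha>\<close> by (simp add: t_def)
qed

section \<open>The extremal solution\<close>

lemma smooth_on_continuous:
  assumes "smooth_on \<Omega> u"
  shows "continuous_on \<Omega> (iterated_deriv vs u)"
  using assms unfolding smooth_on_def
  by (meson continuous_at_imp_continuous_on differentiable_imp_continuous_within)

lemma smooth_on_dir_deriv:
  assumes "smooth_on \<Omega> u" "x \<in> \<Omega>"
  shows "has_dir_deriv (iterated_deriv vs u) (iterated_deriv (b # vs) u x) b x"
  using assms has_dir_deriv_frechet[of "iterated_deriv vs u" x b] by (simp add: smooth_on_def)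

text \<open>A derivative passes through the sum where the summands are differentiable. The first
  identity holds on the whole open set, so it can be differentiated once more to give the
  second.\<close>

lemma smooth_on_laplacian_deriv:
  fixes u :: "'a::euclidean_space \<Rightarrow> real"
  assumes u: "smooth_on \<Omega> u" and x: "x \<in> \<Omega>"
  shows "iterated_deriv [b] (laplacian u) x = (\<Sum>c\<in>Basis. iterated_deriv [b, c, c] u x)"
    and "iterated_deriv [a, b] (laplacian u) x = (\<Sum>c\<in>Basis. iterated_deriv [a, b, c, c] u x)"
proof -
  have d: "(iterated_deriv vs u has_derivative frechet_derivative (iterated_deriv vs u) (at y)) (at y)"
    if "y \<in> \<Omega>" for vs y
    using u that by (simp add: smooth_on_def frechet_derivative_works)
  have sum: "((\<lambda>y. \<Sum>c\<in>Basis. iterated_deriv (vs c) u y) has_derivative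
      (\<lambda>h. \<Sum>c\<in>Basis. iterated_deriv (h # vs c) u y)) (at y)" if "y \<in> \<Omega>" for vs :: "'a \<Rightarrow> 'a list" and y
    using d[OF that] by (auto intro!: has_derivative_sum)
  have 1: "iterated_deriv [b] (laplacian u) y = (\<Sum>c\<in>Basis. iterated_deriv [b, c, c] u y)" if "y \<in> \<Omega>" for y
  proof -
    have "laplacian u = (\<lambda>y. \<Sum>c\<in>Basis. iterated_deriv [c, c] u y)"
      by (simp add: laplacian_def fun_eq_iff)
    then have "(laplacian u has_derivative (\<lambda>h. \<Sum>c\<in>Basis. iterated_deriv (h # [c, c]) u y)) (at y)"
      using sum[OF that, of "\<lambda>c. [c, c]"] by (simp only:)
    from fun_cong[OF frechet_derivative_at[OF this], of b] show ?thesis by simp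
  qed
  show "iterated_deriv [b] (laplacian u) x = (\<Sum>c\<in>Basis. iterated_deriv [b, c, c] u x)"
    by (rule 1[OF x])
  have "open \<Omega>" using u by (simp add: smooth_on_def)
  have "(iterated_deriv [b] (laplacian u) has_derivative
      (\<lambda>h. \<Sum>c\<in>Basis. iterated_deriv (h # [b, c, c]) u x)) (at x)"
    by (rule has_derivative_transform_within_open[OF sum[OF x, of "\<lambda>c. [b, c, c]"] \<open>open \<Omega>\<close> x])
      (simp only: 1)
  from fun_cong[OF frechet_derivative_at[OF this], of a]
  show "iterated_deriv [a, b] (laplacian u) x = (\<Sum>c\<in>Basis. iterated_deriv [a, b, c, c] u x)"
    by simp
qed

text \<open>The values of a solution off the closure are arbitrary, so u is cut to 0 outside
  \<Omega>, and v is minus the Laplacian cut likewise. The Navier conditions make both continuous on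
  the whole space.\<close>

lemma navier_system_of_smooth_solution:
  fixes \<Omega> :: "'a::euclidean_space set"
  assumes \<Omega>: "smooth_bounded_domain \<Omega>" and "1 < p" "0 < l" and sol: "smooth_solution \<Omega> p l u"
  obtains v u1 u2 v1 v2 where
    "navier_system \<Omega> p l (\<lambda>x. if x \<in> \<Omega> then u x else 0) v u1 u2 v1 v2"
proof -
  let ?u = "\<lambda>x. if x \<in> \<Omega> then u x else 0"
  let ?v = "\<lambda>x. if x \<in> \<Omega> then - laplacian u x else 0"
  let ?v1 = "\<lambda>b x. - (\<Sum>c\<in>Basis. iterated_deriv [b, c, c] u x)"
  let ?v2 = "\<lambda>b x. - (\<Sum>c\<in>Basis. iterated_deriv [b, b, c, c] u x)"
  have op: "open \<Omega>" and bd: "bounded \<Omega>" using \<Omega> by (auto simp: smooth_bounded_domain_def)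
  have sm: "smooth_on \<Omega> u" and cl: "continuous_on (closure \<Omega>) u"
    using sol by (auto simp: smooth_solution_def smooth_on_closure_def)
  have fr: "u y = 0" "(laplacian u \<longlongrightarrow> 0) (at y within \<Omega>)" if "y \<in> frontier \<Omega>" for y
    using sol that by (auto simp: smooth_solution_def)
  have D: "has_dir_deriv (\<lambda>y. - (\<Sum>c\<in>Basis. iterated_deriv (vs c) u y))
      (- (\<Sum>c\<in>Basis. iterated_deriv (b # vs c) u x)) b x"
    if "x \<in> \<Omega>" for vs :: "'a \<Rightarrow> 'a list" and b x
    unfolding has_dir_deriv_def
    by (intro DERIV_minus DERIV_sum) (use smooth_on_dir_deriv[OF sm that] in \<open>simp only: has_dir_deriv_def\<close>)
  have cont: "continuous_on \<Omega> (\<lambda>y. - (\<Sum>c\<in>Basis. iterated_deriv (vs c) u y))"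
    for vs :: "'a \<Rightarrow> 'a list"
    by (intro continuous_on_minus continuous_on_sum smooth_on_continuous[OF sm])
  have "navier_system \<Omega> p l ?u ?v (\<lambda>b. iterated_deriv [b] u) (\<lambda>b. iterated_deriv [b, b] u) ?v1 ?v2"
  proof
    show "continuous_on UNIV ?u"
    proof (rule continuous_on_zero_extension[OF op])
      show "continuous_on \<Omega> u" using cl closure_subset by (rule continuous_on_subset)
      show "(u \<longlongrightarrow> 0) (at y within \<Omega>)" if "y \<in> frontier \<Omega>" for y
      proof -
        have "(u \<longlongrightarrow> u y) (at y within closure \<Omega>)"
          using cl that by (auto simp: continuous_on_def frontier_def)
        then show ?thesis using fr(1)[OF that] tendsto_within_subset closure_subset by metis
      qed
    qed
    show "continuous_on UNIV ?v"
    proof (rule continuous_on_zero_extension[OF op])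
      show "continuous_on \<Omega> (\<lambda>x. - laplacian u x)"
        unfolding laplacian_def by (rule cont)
      show "((\<lambda>x. - laplacian u x) \<longlongrightarrow> 0) (at y within \<Omega>)" if "y \<in> frontier \<Omega>" for y
        using tendsto_minus[OF fr(2)[OF that]] by simp
    qed
    show "c2_on \<Omega> ?u (\<lambda>b. iterated_deriv [b] u) (\<lambda>b. iterated_deriv [b, b] u)"
    proof -
      have "has_dir_deriv ?u (iterated_deriv [b] u x) b x" if "x \<in> \<Omega>" for b x
        using smooth_on_dir_deriv[OF sm that, of "[]" b] op that
        by (rule has_dir_deriv_cong_open) simp
      moreover have "continuous_on \<Omega> ?u"
        using smooth_on_continuous[OF sm, of "[]"] by (rule continuous_on_eq) simp
      ultimately show ?thesis
        unfolding c2_on_def c1_on_def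
        by (auto simp only: smooth_on_continuous[OF sm] smooth_on_dir_deriv[OF sm])
    qed
    show "c2_on \<Omega> ?v ?v1 ?v2"
    proof -
      have "has_dir_deriv ?v (?v1 b x) b x" if "x \<in> \<Omega>" for b x
        by (rule has_dir_deriv_cong_open[OF D[OF that, of "\<lambda>c. [c, c]" b] op that])
          (simp add: laplacian_def)
      moreover have "continuous_on \<Omega> ?v"
        by (rule continuous_on_eq[OF cont[of "\<lambda>c. [c, c]"]]) (simp add: laplacian_def)
      ultimately show ?thesis
        unfolding c2_on_def c1_on_def using cont D by (auto simp only:)
    qed
    show "(\<Sum>b\<in>Basis. iterated_deriv [b, b] u x) = - ?v x" if "x \<in> \<Omega>" for x
      using that by (simp add: laplacian_def)
    show "(\<Sum>b\<in>Basis. ?v2 b x) = - (l * (?u x + 1) powr p)" if "x \<in> \<Omega>" for x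
    proof -
      have "(\<Sum>b\<in>Basis. ?v2 b x) = - laplacian (laplacian u) x"
        unfolding laplacian_def[of "laplacian u"] smooth_on_laplacian_deriv(2)[OF sm that]
        by (simp only: sum_negf)
      then show ?thesis using sol that by (simp add: smooth_solution_def)
    qed
  qed (use assms op bd in auto)
  then show ?thesis by (rule that)
qed

theorem theorem2:
  fixes \<Omega> :: "'a::euclidean_space set" and p :: real and ustar :: "'a \<Rightarrow> ereal"
  assumes "DIM('a) \<ge> 2"
    and "smooth_bounded_domain \<Omega>"
    and "p > 1"
    and "real DIM('a) / 4 <
           p / (p - 1) + (p + 1) / (p - 1) *
             (sqrt (2 * p / (p + 1)) + sqrt (2 * p / (p + 1) - sqrt (2 * p / (p + 1))) - 1 / 2)"
    and "extremal_solution \<Omega> p ustar"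
  shows "ustar \<in> borel_measurable (lebesgue_on \<Omega>) \<and>
         esssup (lebesgue_on \<Omega>) (\<lambda>x. \<bar>ustar x\<bar>) < \<infinity>"
proof -
  obtain L u where L: "0 < L" and branch: "minimal_branch \<Omega> p L u"
    and lim: "\<And>x. x \<in> \<Omega> \<Longrightarrow> ((\<lambda>l. ereal (u l x)) \<longlongrightarrow> ustar x) (at_left L)"
    using assms(5) unfolding extremal_solution_def by blast
  have op: "open \<Omega>" and bd: "bounded \<Omega>" using assms(2) by (auto simp: smooth_bounded_domain_def)
  obtain \<alpha> where \<alpha>: "1 < \<alpha>" "\<alpha>\<^sup>2 / (2 * \<alpha> - 1) < sqrt (2 * p / (p + 1))"
    "(p - 1) * real DIM('a) / 4 < (p - 1) / 2 + (p + 1) * \<alpha>"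
    using semistable_exponent[OF assms(3,4)] by blast
  \<comment> \<open>The limit only involves parameters in [L/2, L), which stay away from 0.\<close>
  have L2: "0 < L / 2" using L by simp
  let ?ns = "navier_system \<Omega> p"
  obtain C0 where C0: "\<And>l u v u1 u2 v1 v2. ?ns l u v u1 u2 v1 v2 \<Longrightarrow> navier_system.semistable \<Omega> p l u \<Longrightarrow>
      L / 2 \<le> l \<Longrightarrow> l \<le> L \<Longrightarrow> (LBINT x:closure \<Omega>. (u x + 1) powr ((p - 1) / 2 + (p + 1) * \<alpha>)) \<le> C0"
    using integral_bound_of_semistable[OF assms(3) L2 \<alpha>(1,2), of \<Omega> L] by blast
  obtain B where B: "\<And>l u v u1 u2 v1 v2 x. ?ns l u v u1 u2 v1 v2 \<Longrightarrow> L / 2 \<le> l \<Longrightarrow> l \<le> L \<Longrightarrow>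
      (LBINT x:closure \<Omega>. (u x + 1) powr ((p - 1) / 2 + (p + 1) * \<alpha>)) \<le> C0 \<Longrightarrow> u x \<le> B"
    using sup_bound_of_integral_bound[OF assms(1) bd assms(3) L2 \<alpha>(3), of L C0] by blast
  have sol: "smooth_solution \<Omega> p l (u l)" if "0 < l" "l < L" for l
    using branch that by (simp add: minimal_branch_def minimal_solution_def)
  have bound: "0 \<le> u l x" "u l x \<le> B" if l: "L / 2 \<le> l" "l < L" and x: "x \<in> \<Omega>" for l x
  proof -
    have l0: "0 < l" using l L by simp
    obtain v u1 u2 v1 v2 where ns: "?ns l (\<lambda>x. if x \<in> \<Omega> then u l x else 0) v u1 u2 v1 v2"
      using navier_system_of_smooth_solution[OF assms(2,3) l0 sol[OF l0 l(2)]] .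
    \<comment> \<open>Since l < L there is room for a second member of the branch; strict
      monotonicity puts it strictly above the first, as semistability requires.\<close>
    obtain m where m: "l < m" "m < L" using dense l(2) by blast
    then have m0: "0 < m" using l0 by simp
    obtain v' u1' u2' v1' v2' where ns': "?ns m (\<lambda>x. if x \<in> \<Omega> then u m x else 0) v' u1' u2' v1' v2'"
      using navier_system_of_smooth_solution[OF assms(2,3) m0 sol[OF m0 m(2)]] .
    have "u l x < u m x" if "x \<in> \<Omega>" for x
      using branch that m l0 unfolding minimal_branch_def strict_mono_on_def by auto
    then have "navier_system.semistable \<Omega> p l (\<lambda>x. if x \<in> \<Omega> then u l x else 0)"
      by (intro navier_system.semistableI[OF ns ns' m(1)]) simp
    from B[OF ns l(1) less_imp_le[OF l(2)] C0[OF ns this l(1) less_imp_le[OF l(2)]], of x]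
    show "u l x \<le> B" using x by simp
    show "0 \<le> u l x" using navier_system.u_nonneg[OF ns, of x] x by simp
  qed
  have near: "eventually (\<lambda>l. L / 2 \<le> l \<and> l < L) (at_left L)"
    using L by (auto simp: eventually_at_left[of "0"] intro!: exI[of _ "L / 2"])
  have range: "0 \<le> ustar x" "ustar x \<le> ereal B" if x: "x \<in> \<Omega>" for x
  proof -
    show "0 \<le> ustar x"
      by (rule tendsto_lowerbound[OF lim[OF x]]) (use near bound(1) x in \<open>auto elim: eventually_mono\<close>)
    show "ustar x \<le> ereal B"
      by (rule tendsto_upperbound[OF lim[OF x]]) (use near bound(2) x in \<open>auto elim: eventually_mono\<close>)
  qed
  have meas: "ustar \<in> borel_measurable (lebesgue_on \<Omega>)"
  proof (rule borel_measurable_LIMSEQ_order)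
    \<comment> \<open>The denominator is k + 2 because k + 1 would give the value 0 at k = 0,
      outside the branch.\<close>
    define s where "s k = L - L / real (Suc (Suc k))" for k
    have s: "0 < s k" "s k < L" for k using L by (auto simp: s_def field_simps add_pos_nonneg)
    have "(\<lambda>k. L / real (Suc (Suc k))) \<longlonglongrightarrow> 0"
      by (intro LIMSEQ_Suc lim_const_over_n)
    then have "s \<longlonglongrightarrow> L"
      unfolding s_def[abs_def] using tendsto_diff[OF tendsto_const[of L]] by fastforce
    then have "filterlim s (at_left L) sequentially"
      using s by (auto simp: filterlim_at intro!: always_eventually)
    then show "(\<lambda>k. ereal (u (s k) x)) \<longlonglongrightarrow> ustar x" if "x \<in> space (lebesgue_on \<Omega>)" for x
      using lim[of x] that by (auto intro: filterlim_compose)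
    show "(\<lambda>x. ereal (u (s k) x)) \<in> borel_measurable (lebesgue_on \<Omega>)" for k
    proof -
      have "continuous_on (closure \<Omega>) (u (s k))"
        using sol[OF s] by (simp add: smooth_solution_def smooth_on_closure_def)
      then have "continuous_on \<Omega> (u (s k))" using closure_subset by (rule continuous_on_subset)
      then have "u (s k) \<in> borel_measurable (lebesgue_on \<Omega>)"
        using op by (intro continuous_imp_measurable_on_sets_lebesgue) auto
      then show ?thesis by simp
    qed
  qed
  moreover have "esssup (lebesgue_on \<Omega>) (\<lambda>x. \<bar>ustar x\<bar>) \<le> ereal B"
    by (rule esssup_I) (use meas range in auto)
  ultimately show ?thesis by (auto intro: order.strict_trans1)
qed

end
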